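(* Let $X$ be one of the complex Banach sequence spaces $\ell^p$ ($1\le p\le\infty$), $c$, or $c_0$. Let $a=(a_n)\in\ell^\infty$ with $a_n>0$ for all $n\in\mathbb{N}$ (and $a\in c$ if $X=c$), and let $b=(b_n)\in X$. Suppose that there exists a negative real sequence $\lambda=(\lambda_n)$ such that $k(\lambda)\in X^*$ and $T_{k(\lambda)}=A+bk(\lambda)$ is diagonalizable. Then the following hold: (C1) $(a_n)$ and $(|\lambda_n|)$ uniformly exponentially decay with $\alpha=1$. (C2) $(|b_n|)$ uniformly exponentially decays. (C3) $(g_n)$ uniformly exponentially decays, where $g_n:=\dfrac{a_n-\lambda_n}{|b_n|}$ for $n\in\mathbb{N}$. Moreover, if we additionally assume that $a_{n+1}/a_n$ is uniformly bounded from below by some $r'\in(0,1)$, then the following hold as well: (C4) $(a_n/|b_n|)$ uniformly exponentially decays. (C5) There exist constants $c_1,c_2>0$ such that $c_1\le |\lambda_n|/a_n\le c_2$ for all $n\in\mathbb{N}$.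
   Context: $\mathbb{N}$ is the set of positive integers. $c$ is the space of convergent complex sequences and $c_0$ the space of null sequences (sequences converging to zero), both with the sup norm. $X^*$ is the dual space of $X$. $A:X\to X$ is the bounded diagonal operator $(x_n)\mapsto(a_nx_n)$. Only functionals $k=(k_n)\in X^*$ of the form $kx=\sum_{n=1}^\infty k_nx_n$ are considered; "$k\in X^*$" for a sequence $k=(k_n)$ means that this formula defines a bounded linear functional on $X$. For such $k$, $T_k:=A+bk$, i.e. $T_kx=Ax+b\,(kx)$, a rank-one perturbation of $A$. For sequences $x=(x_n)$, $y=(y_n)$ with the $y_n$ nonzero and pairwise distinct, $$\pi_n(x,y):=\lim_{N\to\infty}\prod_{m=1,\,m\ne n}^N\frac{1-x_m/y_n}{1-y_m/y_n},\quad n\in\mathbb{N}.$$ When the $a_n$ are pairwise distinct and $b_n\neq0$ for all $n$, the sequence of feedback gains $k(\lambda)=(k_n(\lambda))$ is defined, for a null sequence $\lambda=(\lambda_n)$ with $\mathrm{Re}(\lambda_n)\le 0$ for all $n$, by $$k_n(\lambda):=-\frac{a_n-\lambda_n}{b_n}\,\pi_n(\lambda,a),\quad n\in\mathbb{N};$$ these conditions on $a$, $b$ and $\lambda$ are understood whenever $k(\lambda)$ is written, and the hypothesis $k(\lambda)\in X^*$ includes that the limits $\pi_n(\lambda,a)$ exist. $T_k$ is diagonalizable if there exist bounded linear operators $P,Q:X\to X$, inverses of each other, with $T_k=P\Lambda Q$, where $\Lambda=\mathrm{diag}(\mu_1,\mu_2,\ldots)$ and $\{\mu_1,\mu_2,\ldots\}=\Sigma_{\mathrm{disc}}(T_k)$,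 the discrete spectrum of $T_k$ (isolated eigenvalues of finite algebraic multiplicity). A positive real sequence $(x_n)$ uniformly exponentially decays if there exist constants $\alpha>0$ and $r\in(0,1)$ such that $x_m/x_n\le\alpha r^{m-n}$ for all $m\ge n$; this is also called $(\alpha,r)$-exponential decay. "With $\alpha=1$" means that this holds with $\alpha=1$ and some $r\in(0,1)$.
   Formalization: As written the claim fails, since permuting (a_n) and (b_n) together breaks (C1); here (a_n) (with (b_n) carried along) and (|λ_n|) are each listed in decreasing order, such listings are proved to exist, and (C1)–(C5), including the bound on a_{n+1}/a_n, refer to these listings. *)

theory Defs
  imports "HOL-Complex_Analysis.Complex_Analysis"
begin

text \<open>Sequences are indexed by \<open>nat\<close>: index \<open>n\<close> here is the index \<open>n + 1\<close> when sequences
  start at 1. Only differences of indices and limits enter, so nothing depends on this shift.\<close>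

subsection \<open>The sequence spaces\<close>

datatype seq_space = Ell real | Ell_inf | Conv | Null

text \<open>The last two are \<open>c\<close> and \<open>c\<^sub>0\<close>. \<open>Ell p\<close> is only a Banach space for \<open>p \<ge> 1\<close>.\<close>

fun banach_seq_space :: "seq_space \<Rightarrow> bool" where
  "banach_seq_space (Ell p) = (1 \<le> p)"
| "banach_seq_space Ell_inf = True"
| "banach_seq_space Conv = True"
| "banach_seq_space Null = True"

fun seqs :: "seq_space \<Rightarrow> (nat \<Rightarrow> complex) set" where
  "seqs (Ell p) = {x. summable (\<lambda>n. cmod (x n) powr p)}"
| "seqs Ell_inf = {x. Bseq x}"
| "seqs Conv = {x. convergent x}"
| "seqs Null = {x. x \<longlonglongrightarrow> 0}"

fun seq_norm :: "seq_space \<Rightarrow> (nat \<Rightarrow> complex) \<Rightarrow> real" where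
  "seq_norm (Ell p) x = (\<Sum>n. cmod (x n) powr p) powr (1 / p)"
| "seq_norm Ell_inf x = (SUP n. cmod (x n))"
| "seq_norm Conv x = (SUP n. cmod (x n))"
| "seq_norm Null x = (SUP n. cmod (x n))"

subsection \<open>Operators and functionals\<close>

text \<open>An operator on \<open>X\<close> is a function on all sequences of which only the restriction to
  \<open>seqs X\<close> matters.\<close>

definition bounded_op ::
  "seq_space \<Rightarrow> ((nat \<Rightarrow> complex) \<Rightarrow> (nat \<Rightarrow> complex)) \<Rightarrow> bool" where
  "bounded_op X T \<longleftrightarrow>
     (\<forall>x\<in>seqs X. T x \<in> seqs X) \<and>
     (\<forall>x\<in>seqs X. \<forall>y\<in>seqs X. T (\<lambda>n. x n + y n) = (\<lambda>n. T x n + T y n)) \<and>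
     (\<forall>c. \<forall>x\<in>seqs X. T (\<lambda>n. c * x n) = (\<lambda>n. c * T x n)) \<and>
     (\<exists>C. \<forall>x\<in>seqs X. seq_norm X (T x) \<le> C * seq_norm X x)"

definition inverse_ops ::
  "seq_space \<Rightarrow> ((nat \<Rightarrow> complex) \<Rightarrow> (nat \<Rightarrow> complex)) \<Rightarrow>
     ((nat \<Rightarrow> complex) \<Rightarrow> (nat \<Rightarrow> complex)) \<Rightarrow> bool" where
  "inverse_ops X S T \<longleftrightarrow> (\<forall>x\<in>seqs X. S (T x) = x \<and> T (S x) = x)"

definition diag_op :: "(nat \<Rightarrow> complex) \<Rightarrow> (nat \<Rightarrow> complex) \<Rightarrow> (nat \<Rightarrow> complex)" where
  "diag_op d x = (\<lambda>n. d n * x n)"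

definition functional :: "(nat \<Rightarrow> complex) \<Rightarrow> (nat \<Rightarrow> complex) \<Rightarrow> complex" where
  "functional k x = (\<Sum>n. k n * x n)"

definition in_dual :: "seq_space \<Rightarrow> (nat \<Rightarrow> complex) \<Rightarrow> bool" where
  "in_dual X k \<longleftrightarrow>
     (\<forall>x\<in>seqs X. summable (\<lambda>n. k n * x n)) \<and>
     (\<exists>C. \<forall>x\<in>seqs X. cmod (functional k x) \<le> C * seq_norm X x)"

definition perturbed_op ::
  "(nat \<Rightarrow> complex) \<Rightarrow> (nat \<Rightarrow> complex) \<Rightarrow> (nat \<Rightarrow> complex) \<Rightarrow>
     (nat \<Rightarrow> complex) \<Rightarrow> (nat \<Rightarrow> complex)" where
  "perturbed_op a b k x = (\<lambda>n. diag_op a x n + b n * functional k x)"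

subsection \<open>Discrete spectrum and diagonalizability\<close>

definition shifted_op ::
  "((nat \<Rightarrow> complex) \<Rightarrow> (nat \<Rightarrow> complex)) \<Rightarrow> complex \<Rightarrow>
     (nat \<Rightarrow> complex) \<Rightarrow> (nat \<Rightarrow> complex)" where
  "shifted_op T z x = (\<lambda>n. z * x n - T x n)"

definition op_spectrum ::
  "seq_space \<Rightarrow> ((nat \<Rightarrow> complex) \<Rightarrow> (nat \<Rightarrow> complex)) \<Rightarrow> complex set" where
  "op_spectrum X T = {z. \<not> (\<exists>R. bounded_op X R \<and> inverse_ops X R (shifted_op T z))}"

definition eigenvalue ::
  "seq_space \<Rightarrow> ((nat \<Rightarrow> complex) \<Rightarrow> (nat \<Rightarrow> complex)) \<Rightarrow> complex \<Rightarrow> bool" where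
  "eigenvalue X T z \<longleftrightarrow> (\<exists>x\<in>seqs X. x \<noteq> (\<lambda>_. 0) \<and> T x = (\<lambda>n. z * x n))"

definition resolvent_op ::
  "seq_space \<Rightarrow> ((nat \<Rightarrow> complex) \<Rightarrow> (nat \<Rightarrow> complex)) \<Rightarrow> complex \<Rightarrow>
     (nat \<Rightarrow> complex) \<Rightarrow> (nat \<Rightarrow> complex)" where
  "resolvent_op X T z = inv_into (seqs X) (shifted_op T z)"

text \<open>The Riesz projection \<open>(1 / 2\<pi>i) \<integral> R(w) dw\<close> with \<open>R(w)\<close> the resolvent, over the circle of
  radius \<open>e\<close> about \<open>z\<close>. The integral is taken coordinate by coordinate; since the
  coordinate functionals are continuous on every \<open>X\<close>, this is the norm-convergent integral.\<close>

definition riesz_projection ::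
  "seq_space \<Rightarrow> ((nat \<Rightarrow> complex) \<Rightarrow> (nat \<Rightarrow> complex)) \<Rightarrow> complex \<Rightarrow> real \<Rightarrow>
     (nat \<Rightarrow> complex) \<Rightarrow> (nat \<Rightarrow> complex)" where
  "riesz_projection X T z e x =
     (\<lambda>n. contour_integral (circlepath z e) (\<lambda>w. resolvent_op X T w x n) / (2 * pi * \<i>))"

definition finite_dim :: "(nat \<Rightarrow> complex) set \<Rightarrow> bool" where
  "finite_dim S \<longleftrightarrow>
     (\<exists>d (f :: nat \<Rightarrow> nat \<Rightarrow> complex).
        \<forall>x\<in>S. \<exists>c :: nat \<Rightarrow> complex. x = (\<lambda>n. \<Sum>i<d. c i * f i n))"

text \<open>The algebraic multiplicity of an isolated point of the spectrum is the rank of its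
  Riesz projection; the value does not depend on the admissible radius \<open>e\<close>.\<close>

definition discrete_spectrum ::
  "seq_space \<Rightarrow> ((nat \<Rightarrow> complex) \<Rightarrow> (nat \<Rightarrow> complex)) \<Rightarrow> complex set" where
  "discrete_spectrum X T =
     {z. eigenvalue X T z \<and>
         (\<exists>e>0. op_spectrum X T \<inter> cball z e = {z} \<and>
                finite_dim (riesz_projection X T z e ` seqs X))}"

definition diagonalizable ::
  "seq_space \<Rightarrow> ((nat \<Rightarrow> complex) \<Rightarrow> (nat \<Rightarrow> complex)) \<Rightarrow> bool" where
  "diagonalizable X T \<longleftrightarrow>
     (\<exists>P Q \<mu>. bounded_op X P \<and> bounded_op X Q \<and> inverse_ops X P Q \<and>
        bounded_op X (diag_op \<mu>) \<and>
        (\<forall>x\<in>seqs X. T x = P (diag_op \<mu> (Q x))) \<and>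
        range \<mu> = discrete_spectrum X T)"

subsection \<open>Feedback gains\<close>

definition partial_product ::
  "(nat \<Rightarrow> complex) \<Rightarrow> (nat \<Rightarrow> complex) \<Rightarrow> nat \<Rightarrow> nat \<Rightarrow> complex" where
  "partial_product x y n N = (\<Prod>m\<in>{..<N} - {n}. (1 - x m / y n) / (1 - y m / y n))"

definition pi_lim :: "(nat \<Rightarrow> complex) \<Rightarrow> (nat \<Rightarrow> complex) \<Rightarrow> nat \<Rightarrow> complex" where
  "pi_lim x y n = lim (partial_product x y n)"

definition gain ::
  "(nat \<Rightarrow> complex) \<Rightarrow> (nat \<Rightarrow> complex) \<Rightarrow> (nat \<Rightarrow> complex) \<Rightarrow> nat \<Rightarrow> complex" where
  "gain a b l n = - ((a n - l n) / b n) * pi_lim l a n"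

text \<open>The conditions under which \<open>gain a b l\<close> is meaningful. Limits are total here, so the
  existence of the limits of the partial products has to be required explicitly.\<close>

definition gain_defined ::
  "(nat \<Rightarrow> complex) \<Rightarrow> (nat \<Rightarrow> complex) \<Rightarrow> (nat \<Rightarrow> complex) \<Rightarrow> bool" where
  "gain_defined a b l \<longleftrightarrow>
     inj a \<and> (\<forall>n. a n \<noteq> 0) \<and> (\<forall>n. b n \<noteq> 0) \<and>
     l \<longlonglongrightarrow> 0 \<and> (\<forall>n. Re (l n) \<le> 0) \<and>
     (\<forall>n. convergent (partial_product l a n))"

subsection \<open>Exponential decay\<close>

definition exp_decay :: "real \<Rightarrow> real \<Rightarrow> (nat \<Rightarrow> real) \<Rightarrow> bool" where
  "exp_decay \<alpha> r x \<longleftrightarrow>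
     (\<forall>n. x n > 0) \<and> \<alpha> > 0 \<and> 0 < r \<and> r < 1 \<and>
     (\<forall>n m. n \<le> m \<longrightarrow> x m / x n \<le> \<alpha> * r ^ (m - n))"

definition unif_exp_decay :: "(nat \<Rightarrow> real) \<Rightarrow> bool" where
  "unif_exp_decay x \<longleftrightarrow> (\<exists>\<alpha> r. exp_decay \<alpha> r x)"

definition unif_exp_decay_one :: "(nat \<Rightarrow> real) \<Rightarrow> bool" where
  "unif_exp_decay_one x \<longleftrightarrow> (\<exists>r. exp_decay 1 r x)"

text \<open>Exponential decay with \<open>\<alpha> = 1\<close> forces a sequence to be strictly decreasing, whereas
  nothing else about the perturbed operator sees the order of the coordinates (the same
  permutation applied to \<open>a\<close> and \<open>b\<close>, and an independent one applied to \<open>l\<close>). Decay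
  statements therefore refer to the terms listed in decreasing order, which is what a bijection
  \<open>\<sigma>\<close> with the following property does; the identity qualifies if \<open>x\<close> is already
  decreasing.\<close>

definition decreasing_listing :: "(nat \<Rightarrow> nat) \<Rightarrow> (nat \<Rightarrow> real) \<Rightarrow> bool" where
  "decreasing_listing \<sigma> x \<longleftrightarrow> bij \<sigma> \<and> decseq (\<lambda>n. x (\<sigma> n))"

end

theory Submission
  imports Defs
begin

text \<open>
  Write \<open>\<lambda>\<close> for the sequence \<open>l\<close>. List \<open>a\<close> and \<open>\<bar>\<lambda>\<bar>\<close> in decreasing order as \<open>\<alpha>\<close> and \<open>\<beta>\<close>, carry \<open>\<bar>b\<bar>\<close> along with \<open>a\<close> as \<open>B\<close>, and
  put \<open>g n = (\<alpha> n + \<beta> n) / B n\<close>. The gains are chosen so that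
  \<open>1 - k (z - A)\<^sup>-\<^sup>1 b = \<Prod>m. (z - \<lambda> m) / (z - a m)\<close>: the products \<open>k n * b n\<close> are minus the residues
  of the right-hand side. Hence each \<open>\<lambda> j\<close> is an eigenvalue of the perturbed operator, with
  one-dimensional eigenspace spanned by the sequence \<open>b n / (\<lambda> j - a n)\<close>, and the left eigenvectors
  are the multiples of \<open>k n / (\<lambda> j - a n)\<close>. If the operator is \<open>P \<Lambda> Q\<close>, the columns of \<open>P\<close> and the
  rows of \<open>Q\<close> that belong to \<open>\<lambda> j\<close> are therefore scaled Cauchy vectors, and \<open>Q P = 1\<close> ties the product
  of the two scalars to the derivative of the product at \<open>\<lambda> j\<close> (\<open>diagonal_form_entries\<close>).

  This makes the product of matching entries of \<open>P\<close> and \<open>Q\<close> explicit. For the \<open>i\<close>-th largest \<open>a\<close> and the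
  \<open>i\<close>-th largest \<open>\<bar>\<lambda>\<bar>\<close> its absolute value is
  \<open>\<Prod>m\<noteq>i. (\<alpha> i + \<beta> m) (\<beta> i + \<alpha> m) / ((\<alpha> i - \<alpha> m) (\<beta> i - \<beta> m))\<close>, and every factor exceeds \<open>1\<close>, since
  its numerator exceeds its denominator by \<open>(\<alpha> i + \<beta> i) (\<alpha> m + \<beta> m)\<close> (\<open>residue_ratio_bounds\<close>). Two
  consequences carry the whole proof (\<open>sorted_eigenvector_bounds\<close>).

  First, \<open>P\<close> and \<open>Q\<close> are bounded, so the product, and with it each factor, is at most some \<open>K\<close>. This
  forces \<open>\<alpha> (n + 1) \<le> (1 - 1 / K) \<alpha> n\<close> and the same for \<open>\<beta>\<close>, and also the interlacing
  \<open>\<beta> (n + 1) \<le> K \<alpha> n\<close> and \<open>\<alpha> (n + 1) \<le> K \<beta> n\<close> (\<open>cross_ratio_bound\<close>). If in addition \<open>\<alpha>\<close> decays at most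
  geometrically, interlacing makes \<open>\<alpha>\<close> and \<open>\<beta>\<close> comparable.

  Second, the product is at least \<open>1\<close>, so the diagonal entries of \<open>P\<close> are bounded away from \<open>0\<close>, and
  the scalar of column \<open>j\<close> is at least a multiple of \<open>g j\<close>. By monotonicity of \<open>\<alpha>\<close> and \<open>\<beta>\<close>, the
  \<open>(n, j)\<close> entry of \<open>P\<close> is then at least a multiple of \<open>B n / B j\<close> for \<open>n \<ge> j\<close> and of \<open>g j / g n\<close> for
  \<open>n \<le> j\<close>. In \<open>\<ell>\<^sup>p\<close> with \<open>p < \<infinity>\<close> the columns of \<open>P\<close> are bounded; under the sup norm the rows are
  bounded in \<open>\<ell>\<^sup>1\<close>. Either way all tail sums of a power of \<open>B\<close> or \<open>g\<close>, or all initial sums of its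
  reciprocals, are bounded by a multiple of their extreme term, which is possible only if \<open>B\<close> and \<open>g\<close>
  decay exponentially (\<open>decay_of_cauchy_matrix\<close>).

  The preparation consists in showing that convergence of the products in the definition of the gains
  already makes \<open>a\<close> and \<open>\<lambda>\<close> summable, so that all products and sums may be rearranged.\<close>

section \<open>Exponential decay from sums and ratios\<close>

text \<open>The last term of each partial sum makes up at least the fraction \<open>1 / C\<close> of it, so the partial
  sums grow by a fixed factor at each step, and each term is comparable with its partial sum. The range
  is finite so that the result also applies to a sequence read backwards.\<close>

lemma geometric_growth_of_partial_sums:
  fixes y :: "nat \<Rightarrow> real"
  assumes "C > 1" and pos: "\<And>i. i \<le> N \<Longrightarrow> 0 < y i"
    and sums: "\<And>i. i \<le> N \<Longrightarrow> (\<Sum>k\<le>i. y k) \<le> C * y i"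
    and "n \<le> m" "m \<le> N"
  shows "y n \<le> C * (1 - 1 / C) ^ (m - n) * y m"
proof -
  define S where "S i = (\<Sum>k\<le>i. y k)" for i
  have step: "S i \<le> (1 - 1 / C) * S (Suc i)" if "Suc i \<le> N" for i
  proof -
    have "S (Suc i) \<le> C * y (Suc i)"
      using sums[OF that] by (simp only: S_def)
    then have "S (Suc i) / C \<le> y (Suc i)"
      using \<open>C > 1\<close> by (simp add: field_simps)
    moreover have "S i = S (Suc i) - y (Suc i)"
      by (simp add: S_def)
    ultimately show ?thesis
      by (simp add: algebra_simps)
  qed
  have iter: "n + d \<le> N \<Longrightarrow> S n \<le> (1 - 1 / C) ^ d * S (n + d)" for d
  proof (induction d)
    case (Suc d)
    have "S n \<le> (1 - 1 / C) ^ d * S (n + d)"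
      using Suc by simp
    also have "\<dots> \<le> (1 - 1 / C) ^ d * ((1 - 1 / C) * S (Suc (n + d)))"
      using step[of "n + d"] Suc.prems \<open>C > 1\<close> by (intro mult_left_mono) auto
    finally show ?case
      by (simp add: mult.assoc mult.left_commute)
  qed auto
  have "(\<Sum>k\<in>{..n} - {n}. y k) \<ge> 0"
    using pos assms(4,5) by (intro sum_nonneg less_imp_le pos) auto
  moreover have "S n = y n + (\<Sum>k\<in>{..n} - {n}. y k)"
    unfolding S_def by (intro sum.remove) auto
  ultimately have "y n \<le> S n"
    by simp
  also have "\<dots> \<le> (1 - 1 / C) ^ (m - n) * S m"
    using iter[of "m - n"] assms(4,5) by simp
  also have "\<dots> \<le> (1 - 1 / C) ^ (m - n) * (C * y m)"
    using sums[of m] assms by (intro mult_left_mono) (auto simp: S_def)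
  finally show ?thesis
    by (simp add: mult_ac)
qed

lemma unif_exp_decay_of_inverse_sums:
  fixes x :: "nat \<Rightarrow> real"
  assumes pos: "\<And>n. 0 < x n" and sums: "\<And>m. (\<Sum>n\<le>m. 1 / x n) \<le> C / x m"
  shows "unif_exp_decay x"
proof -
  define K where "K = max C 2"
  have K: "K > 1" "C \<le> K"
    by (auto simp: K_def)
  have "(\<Sum>k\<le>i. 1 / x k) \<le> K * (1 / x i)" for i
  proof -
    have "C / x i \<le> K / x i"
      using K pos[of i] by (intro divide_right_mono) auto
    then show ?thesis
      using sums[of i] by simp
  qed
  then have decay: "1 / x n \<le> K * (1 - 1 / K) ^ (m - n) * (1 / x m)" if "n \<le> m" for n m
    using geometric_growth_of_partial_sums[of K m "\<lambda>k. 1 / x k" n m] K pos that by simp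
  have "x m / x n \<le> K * (1 - 1 / K) ^ (m - n)" if "n \<le> m" for n m
    using mult_right_mono[OF decay[OF that], of "x m"] pos[of m] by simp
  then have "exp_decay K (1 - 1 / K) x"
    using K pos by (auto simp: exp_decay_def)
  then show ?thesis
    by (auto simp: unif_exp_decay_def)
qed

text \<open>Read backwards from an index \<open>m\<close>, the tail sums up to \<open>m\<close> become partial sums.\<close>

lemma unif_exp_decay_of_tail_sums:
  fixes x :: "nat \<Rightarrow> real"
  assumes pos: "\<And>n. 0 < x n" and sums: "\<And>n N. n \<le> N \<Longrightarrow> (\<Sum>m=n..N. x m) \<le> C * x n"
  shows "unif_exp_decay x"
proof -
  define K where "K = max C 2"
  have K: "K > 1" "C \<le> K"
    by (auto simp: K_def)
  have decay: "x m \<le> K * (1 - 1 / K) ^ (m - n) * x n" if "n \<le> m" for n m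
  proof -
    have "(\<Sum>k\<le>i. x (m - k)) \<le> K * x (m - i)" if "i \<le> m" for i
    proof -
      have "(\<Sum>k\<le>i. x (m - k)) = (\<Sum>k=m-i..m. x k)"
        using that by (intro sum.reindex_bij_witness[of _ "\<lambda>k. m - k" "\<lambda>k. m - k"]) auto
      also have "\<dots> \<le> C * x (m - i)"
        by (rule sums) simp
      also have "\<dots> \<le> K * x (m - i)"
        using K pos[of "m - i"] by (intro mult_right_mono) auto
      finally show ?thesis .
    qed
    then show ?thesis
      using geometric_growth_of_partial_sums[of K m "\<lambda>k. x (m - k)" 0 "m - n"] K pos that
      by simp
  qed
  have "x m / x n \<le> K * (1 - 1 / K) ^ (m - n)" if "n \<le> m" for n m
    using decay[OF that] pos[of n] by (simp add: divide_le_eq)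
  then have "exp_decay K (1 - 1 / K) x"
    using K pos by (auto simp: exp_decay_def)
  then show ?thesis
    by (auto simp: unif_exp_decay_def)
qed

lemma unif_exp_decay_of_powr:
  fixes x :: "nat \<Rightarrow> real"
  assumes pos: "\<And>n. 0 < x n" and "p > 0" and "unif_exp_decay (\<lambda>n. x n powr p)"
  shows "unif_exp_decay x"
proof -
  obtain A r where A: "A > 0" "0 < r" "r < 1"
    "\<And>n m. n \<le> m \<Longrightarrow> x m powr p / x n powr p \<le> A * r ^ (m - n)"
    using assms(3) unfolding unif_exp_decay_def exp_decay_def by blast
  have "x m / x n \<le> A powr (1 / p) * (r powr (1 / p)) ^ (m - n)" if "n \<le> m" for n m
  proof -
    have "((x m / x n) powr p) powr (1 / p) \<le> (A * r ^ (m - n)) powr (1 / p)"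
      using A(4)[OF that] pos[of n] pos[of m] \<open>p > 0\<close>
      by (intro powr_mono2) (auto simp: powr_divide)
    then show ?thesis
      using pos[of n] pos[of m] \<open>p > 0\<close> A
      by (simp add: powr_powr powr_mult powr_realpow[symmetric] mult.commute)
  qed
  moreover have "r powr (1 / p) < 1"
    using A \<open>p > 0\<close> powr_less_mono2[of "1 / p" r 1] by simp
  ultimately have "exp_decay (A powr (1 / p)) (r powr (1 / p)) x"
    using A pos by (auto simp: exp_decay_def)
  then show ?thesis
    by (auto simp: unif_exp_decay_def)
qed

lemma unif_exp_decay_of_comparable:
  fixes x y :: "nat \<Rightarrow> real"
  assumes "unif_exp_decay x" and "0 < c" and c: "\<And>n. c * x n \<le> y n" "\<And>n. y n \<le> x n"
  shows "unif_exp_decay y"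
proof -
  obtain A r where A: "A > 0" "0 < r" "r < 1" "\<And>n. 0 < x n"
    "\<And>n m. n \<le> m \<Longrightarrow> x m / x n \<le> A * r ^ (m - n)"
    using assms(1) unfolding unif_exp_decay_def exp_decay_def by blast
  have y: "0 < y n" for n
    using mult_pos_pos[OF \<open>0 < c\<close> A(4)] c(1) by (rule less_le_trans)
  have "y m / y n \<le> A / c * r ^ (m - n)" if "n \<le> m" for n m
  proof -
    have "y m / y n \<le> x m / (c * x n)"
      using c y[of m] A(4) \<open>0 < c\<close> by (intro frac_le) (auto simp: less_imp_le)
    also have "\<dots> = x m / x n / c"
      by simp
    also have "\<dots> \<le> A * r ^ (m - n) / c"
      using A(5)[OF that] \<open>0 < c\<close> by (intro divide_right_mono) auto
    finally show ?thesis
      by simp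
  qed
  then have "exp_decay (A / c) r y"
    using A y \<open>0 < c\<close> by (auto simp: exp_decay_def)
  then show ?thesis
    by (auto simp: unif_exp_decay_def)
qed

lemma unif_exp_decay_one_of_ratio:
  fixes x :: "nat \<Rightarrow> real"
  assumes "q < 1" and pos: "\<And>n. 0 < x n" and step: "\<And>n. x (Suc n) \<le> q * x n"
  shows "unif_exp_decay_one x"
proof -
  have "0 < q * x 0"
    using pos[of "Suc 0"] step[of 0] by linarith
  then have "0 < q"
    using pos[of 0] by (simp add: zero_less_mult_iff)
  have "x (n + d) \<le> q ^ d * x n" for n d
  proof (induction d)
    case (Suc d)
    have "x (n + Suc d) \<le> q * x (n + d)"
      using step[of "n + d"] by simp
    also have "\<dots> \<le> q * (q ^ d * x n)"
      using Suc \<open>0 < q\<close> by (intro mult_left_mono) auto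
    finally show ?case
      by (simp add: mult_ac)
  qed simp
  then have "x m / x n \<le> 1 * q ^ (m - n)" if "n \<le> m" for n m
    using pos[of n] that le_Suc_ex[OF that] by (auto simp: divide_le_eq)
  then have "exp_decay 1 q x"
    unfolding exp_decay_def using \<open>0 < q\<close> \<open>q < 1\<close> pos by auto
  then show ?thesis
    by (auto simp: unif_exp_decay_one_def)
qed

section \<open>Decreasing listings\<close>

text \<open>Only finitely many terms precede a given one in decreasing order (ties are broken by the index),
  so its position in that order is a natural number. Every position is taken: the terms before one at
  the least position above a free position \<open>k\<close> would all have to fit into the positions below \<open>k\<close>.\<close>

lemma decreasing_listing_exists:
  fixes x :: "nat \<Rightarrow> real"
  assumes "x \<longlonglongrightarrow> 0" and pos: "\<And>n. 0 < x n"
  shows "\<exists>\<sigma>. decreasing_listing \<sigma> x"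
proof -
  define before where "before m n \<longleftrightarrow> x n < x m \<or> x m = x n \<and> m < n" for m n
  define rank where "rank n = card {m. before m n}" for n
  have fin: "finite {m. before m n}" for n
  proof -
    obtain M where M: "\<And>m. m \<ge> M \<Longrightarrow> x m < x n"
      using order_tendstoD(2)[OF assms(1) pos[of n]] by (auto simp: eventually_sequentially)
    have "{m. before m n} \<subseteq> {..<M}"
    proof
      fix m assume "m \<in> {m. before m n}"
      then have "x n \<le> x m"
        by (auto simp: before_def)
      then show "m \<in> {..<M}"
        using M[of m] by (cases "M \<le> m") auto
    qed
    then show ?thesis
      by (rule finite_subset) simp
  qed
  have rank_mono: "rank m < rank n" if "before m n" for m n
  proof -
    have "{k. before k m} \<subset> {k. before k n}"
      using that unfolding before_def by (auto simp: psubset_eq set_eq_iff)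
    then show ?thesis
      unfolding rank_def by (intro psubset_card_mono fin)
  qed
  have total: "before m n \<or> before n m" if "m \<noteq> n" for m n
    using that unfolding before_def by linarith
  have inj: "inj rank"
    by (rule injI) (metis total rank_mono less_irrefl)
  have "k \<in> range rank" for k
  proof (rule ccontr)
    assume k: "k \<notin> range rank"
    have "infinite (range rank)"
      using inj by (simp add: range_inj_infinite)
    then obtain n0 where n0: "k < rank n0"
      by (metis (no_types, lifting) imageE infinite_nat_iff_unbounded)
    obtain n where n: "k < rank n" "\<And>m. k < rank m \<Longrightarrow> rank n \<le> rank m"
      using ex_has_least_nat[of "\<lambda>n. k < rank n" n0 rank] n0 by blast
    have "rank m < k" if "before m n" for m
      using n(2)[of m] rank_mono[OF that] k by (metis linorder_neqE_nat not_less rangeI)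
    then have "card {m. before m n} \<le> card {..<k}"
      using inj by (intro card_inj_on_le[of rank]) (auto intro: inj_on_subset)
    then show False
      using n(1) by (simp add: rank_def)
  qed
  then have "bij rank"
    using inj by (auto simp: bij_def)
  define \<sigma> where "\<sigma> = inv rank"
  have "bij \<sigma>"
    using \<open>bij rank\<close> unfolding \<sigma>_def by (rule bij_imp_bij_inv)
  have rank\<sigma>: "rank (\<sigma> i) = i" for i
    using \<open>bij rank\<close> unfolding \<sigma>_def by (simp add: bij_is_surj surj_f_inv_f)
  have "x (\<sigma> j) \<le> x (\<sigma> i)" if "i \<le> j" for i j
    using rank_mono[of "\<sigma> j" "\<sigma> i"] that unfolding rank\<sigma> before_def by linarith
  then have "decreasing_listing \<sigma> x"
    using \<open>bij \<sigma>\<close> by (auto simp: decreasing_listing_def decseq_def)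
  then show ?thesis
    by blast
qed

section \<open>Infinite products and rearrangement\<close>

text \<open>Logarithms turn the product into an absolutely convergent series, whose sum is independent of the
  order of its terms. The jump of \<open>Ln\<close> along the negative axis does no harm, as only \<open>exp (Ln u) = u\<close>
  is used.\<close>

lemma tendsto_prod_permuted:
  fixes u :: "nat \<Rightarrow> complex"
  assumes nz: "\<And>m. u m \<noteq> 0" and sm: "summable (\<lambda>m. norm (u m - 1))" and "bij \<tau>"
  shows "(\<lambda>N. \<Prod>m<N. u (\<tau> m)) \<longlonglongrightarrow> exp (\<Sum>\<^sub>\<infinity>m. Ln (u m))"
proof -
  have "summable (\<lambda>m. norm (Ln (u m)))"
  proof (rule summable_comparison_test_ev)
    have "eventually (\<lambda>m. norm (u m - 1) < 1 / 2) sequentially"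
      using order_tendstoD(2)[OF summable_LIMSEQ_zero[OF sm], of "1/2"] by simp
    then show "eventually (\<lambda>m. norm (norm (Ln (u m))) \<le> 2 * norm (u m - 1)) sequentially"
    proof eventually_elim
      case (elim m)
      then show ?case
        using norm_Ln_le[of "u m - 1"] by simp
    qed
    show "summable (\<lambda>m. 2 * norm (u m - 1))"
      using sm by (rule summable_mult)
  qed
  then have "((\<lambda>m. Ln (u m)) has_sum (\<Sum>\<^sub>\<infinity>m. Ln (u m))) UNIV"
    by (intro has_sum_infsum norm_summable_imp_summable_on)
  then have "((\<lambda>m. Ln (u (\<tau> m))) has_sum (\<Sum>\<^sub>\<infinity>m. Ln (u m))) UNIV"
    using has_sum_reindex_bij_betw[OF \<open>bij \<tau>\<close>, of "\<lambda>m. Ln (u m)"] by simp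
  then have "(\<lambda>m. Ln (u (\<tau> m))) sums (\<Sum>\<^sub>\<infinity>m. Ln (u m))"
    by (rule has_sum_imp_sums)
  then have "(\<lambda>N. exp (\<Sum>m<N. Ln (u (\<tau> m)))) \<longlonglongrightarrow> exp (\<Sum>\<^sub>\<infinity>m. Ln (u m))"
    unfolding sums_def by (rule tendsto_exp)
  then show ?thesis
    using nz by (simp add: exp_sum)
qed

lemma suminf_permuted:
  fixes f :: "nat \<Rightarrow> complex"
  assumes "summable (\<lambda>n. norm (f n))" "bij \<sigma>"
  shows "(\<Sum>n. f (\<sigma> n)) = (\<Sum>n. f n)"
proof -
  have "(f has_sum (\<Sum>n. f n)) UNIV"
    by (rule norm_summable_imp_has_sum[OF assms(1) summable_sums[OF summable_norm_cancel[OF assms(1)]]])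
  then have "((\<lambda>n. f (\<sigma> n)) has_sum (\<Sum>n. f n)) UNIV"
    using has_sum_reindex_bij_betw[OF assms(2), of f] by simp
  then show ?thesis
    by (rule has_sum_imp_sums[THEN sums_unique, symmetric])
qed

text \<open>Suppose the largest limit point of \<open>a\<close> is positive, and choose \<open>n\<close> with \<open>a n\<close> close to it. Almost
  all \<open>a m\<close> are less than \<open>2 * a n\<close>, so almost all factors are at least \<open>1\<close>; but infinitely
  many \<open>a m\<close> are close to \<open>a n\<close> and contribute factors of at least \<open>3 / 2\<close>. Hence the positive partial
  products cannot converge.\<close>

lemma null_if_products_converge:
  fixes a L :: "nat \<Rightarrow> real"
  assumes pos: "\<And>n. 0 < a n" and bdd: "Bseq a" and inj: "inj a" and L: "\<And>n. 0 \<le> L n"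
    and conv: "\<And>n. convergent (\<lambda>N. \<Prod>m\<in>{..<N} - {n}. (1 + L m / a n) / \<bar>1 - a m / a n\<bar>)"
  shows "a \<longlonglongrightarrow> 0"
proof (rule ccontr)
  assume "\<not> a \<longlonglongrightarrow> 0"
  define S where "S = {e. infinite {m. e \<le> a m}}"
  obtain e where e: "e > 0" "e \<in> S"
  proof -
    obtain e where e: "e > 0" "\<And>M. \<exists>m\<ge>M. e \<le> a m"
      using \<open>\<not> a \<longlonglongrightarrow> 0\<close> pos unfolding LIMSEQ_iff
      by (metis diff_zero norm_of_real not_less real_norm_def abs_of_pos)
    then have "infinite {m. e \<le> a m}"
      by (auto simp: infinite_nat_iff_unbounded_le)
    then show ?thesis
      using that e by (auto simp: S_def)
  qed
  obtain B where B: "\<And>n. a n \<le> B"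
    using bdd unfolding Bseq_def by (metis abs_le_D1 real_norm_def)
  have "s \<le> B" if "s \<in> S" for s
  proof -
    have "\<exists>m. s \<le> a m"
      using that not_finite_existsD[of "\<lambda>m. s \<le> a m"] unfolding S_def by blast
    then obtain m where "s \<le> a m"
      by blast
    then show ?thesis
      using B[of m] by linarith
  qed
  then have bddS: "bdd_above S"
    by (auto simp: bdd_above_def)
  \<comment> \<open>\<open>l\<close> is the limit superior of \<open>a\<close>.\<close>
  define l where "l = Sup S"
  have l: "l > 0"
    using cSup_upper[OF e(2) bddS] e(1) by (simp add: l_def)
  \<comment> \<open>Both \<open>a m\<close> and \<open>a n\<close> between \<open>3/4 * l\<close> and \<open>5/4 * l\<close> give \<open>a m / a n\<close> between \<open>3/5\<close> and \<open>5/3\<close>.\<close>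
  have "finite {m. 5/4 * l \<le> a m}"
  proof (rule ccontr)
    assume "infinite {m. 5/4 * l \<le> a m}"
    then have "5/4 * l \<in> S"
      unfolding S_def by blast
    then have "5/4 * l \<le> l"
      using cSup_upper[OF _ bddS] unfolding l_def by blast
    then show False
      using l by simp
  qed
  moreover have "infinite {m. 3/4 * l \<le> a m}"
  proof -
    obtain s where "s \<in> S" "3/4 * l < s"
      using less_cSupD[of S "3/4 * l"] e l unfolding l_def by auto
    then show ?thesis
      using infinite_super[of "{m. s \<le> a m}" "{m. 3/4 * l \<le> a m}"] unfolding S_def by force
  qed
  moreover define J where "J = {m. 3/4 * l \<le> a m} - {m. 5/4 * l \<le> a m}"
  ultimately have J: "infinite J"
    by simp
  then obtain n where n: "n \<in> J"
    using not_finite_existsD[of "\<lambda>m. m \<in> J"] by (metis Collect_mem_eq)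
  obtain M where M: "\<And>m. m \<ge> M \<Longrightarrow> a m < 5/4 * l"
    using \<open>finite {m. 5/4 * l \<le> a m}\<close>
    by (metis (mono_tags, lifting) finite_nat_iff_bounded_le mem_Collect_eq not_less
        not_less_eq_eq atMost_iff subset_iff)
  define c where "c m = (1 + L m / a n) / \<bar>1 - a m / a n\<bar>" for m
  define f where "f N = (\<Prod>m\<in>{..<N} - {n}. c m)" for N
  have ne: "a m / a n \<noteq> 1" if "m \<noteq> n" for m
    using that inj pos[of n] by (auto simp: inj_def)
  have cpos: "c m > 0" if "m \<noteq> n" for m
    using that L[of m] pos[of n] ne[OF that] unfolding c_def
    by (intro divide_pos_pos add_pos_nonneg) auto
  have fpos: "f N > 0" for N
    unfolding f_def by (intro prod_pos) (auto intro: cpos)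
  have fSuc: "f (Suc m) = f m * c m" if "m > n" for m
  proof -
    have "{..<Suc m} - {n} = insert m ({..<m} - {n})"
      using that by auto
    then show ?thesis
      by (simp add: f_def)
  qed
  have an: "3/4 * l \<le> a n" "a n < 5/4 * l"
    using n by (auto simp: J_def)
  have cge: "c m * t \<ge> 1" if "\<bar>1 - a m / a n\<bar> \<le> t" "m \<noteq> n" for m t
  proof -
    have "0 < \<bar>1 - a m / a n\<bar>"
      using ne[OF that(2)] by auto
    moreover have "t \<le> (1 + L m / a n) * t"
      using that L[of m] pos[of n] by (auto simp: algebra_simps)
    ultimately show ?thesis
      using that by (simp add: c_def le_divide_eq)
  qed
  have c1: "c m \<ge> 1" if "m \<ge> M" "m \<noteq> n" for m
  proof -
    have "a m / a n \<le> 2"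
      using M[OF that(1)] an l by (simp add: divide_le_eq)
    moreover have "0 < a m / a n"
      using pos by simp
    ultimately show ?thesis
      using cge[of m 1] that by auto
  qed
  have c2: "c m \<ge> 3 / 2" if "m \<in> J" "m \<noteq> n" for m
  proof -
    have "a m / a n \<le> 5/3" "3/5 \<le> a m / a n"
      using that an l by (auto simp: J_def divide_le_eq le_divide_eq)
    then have "\<bar>1 - a m / a n\<bar> \<le> 2/3"
      by linarith
    then show ?thesis
      using cge[of m "2/3"] that by simp
  qed
  obtain p where p: "f \<longlonglongrightarrow> p"
    using conv[of n] by (auto simp: convergent_def f_def[abs_def] c_def)
  define N0 where "N0 = Suc (max M n)"
  have N0: "N0 > M" "N0 > n"
    by (auto simp: N0_def)
  have mono: "f N0 \<le> f (N0 + d)" for d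
  proof (induction d)
    case (Suc d)
    have "f (N0 + d) * 1 \<le> f (N0 + d) * c (N0 + d)"
      using fpos[of "N0 + d"] c1[of "N0 + d"] N0 by (intro mult_left_mono) auto
    then show ?case
      using Suc fSuc[of "N0 + d"] N0 by simp
  qed auto
  have "f N0 \<le> p"
    using p by (rule tendsto_lowerbound)
      (auto intro!: eventually_sequentiallyI[of N0] dest: le_Suc_ex simp: mono)
  then have "p > 0"
    using fpos[of N0] by linarith
  then have "(\<lambda>N. f (Suc N) / f N) \<longlonglongrightarrow> p / p"
    by (intro tendsto_divide p LIMSEQ_Suc) auto
  then have "eventually (\<lambda>N. f (Suc N) / f N < 3 / 2) sequentially"
    using \<open>p > 0\<close> by (intro order_tendstoD(2)) auto
  then obtain N1 where N1: "\<And>N. N \<ge> N1 \<Longrightarrow> f (Suc N) / f N < 3 / 2"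
    by (auto simp: eventually_sequentially)
  obtain m where m: "m \<in> J" "m > max N1 n"
    using J by (meson infinite_nat_iff_unbounded)
  then have "f (Suc m) / f m = c m"
    using fSuc[of m] fpos[of m] by simp
  then show False
    using N1[of m] c2[of m] m by auto
qed

text \<open>As soon as \<open>a m < a n\<close>, the factor with index \<open>m\<close> is at least \<open>1 + (L m + a m) / a n\<close>, and a
  product of such terms dominates the sum.\<close>

lemma summable_if_products_converge:
  fixes a L :: "nat \<Rightarrow> real"
  assumes pos: "\<And>n. 0 < a n" and inj: "inj a" and null: "a \<longlonglongrightarrow> 0" and L: "\<And>n. 0 \<le> L n"
    and conv: "convergent (\<lambda>N. \<Prod>m\<in>{..<N} - {n}. (1 + L m / a n) / \<bar>1 - a m / a n\<bar>)"
  shows "summable a" and "summable L"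
proof -
  define c where "c m = (1 + L m / a n) / \<bar>1 - a m / a n\<bar>" for m
  define f where "f N = (\<Prod>m\<in>{..<N} - {n}. c m)" for N
  have ne: "a m / a n \<noteq> 1" if "m \<noteq> n" for m
    using that inj pos[of n] by (auto simp: inj_def)
  have cpos: "c m > 0" if "m \<noteq> n" for m
    using that L[of m] pos[of n] ne[OF that] unfolding c_def
    by (intro divide_pos_pos add_pos_nonneg) auto
  have fpos: "f N > 0" for N
    unfolding f_def by (intro prod_pos) (auto intro: cpos)
  obtain M0 where M0: "\<And>m. m \<ge> M0 \<Longrightarrow> a m < a n"
    using order_tendstoD(2)[OF null pos[of n]] by (auto simp: eventually_sequentially)
  define M where "M = max M0 (Suc n)"
  define x where "x m = (L m + a m) / a n" for m
  have x0: "x m \<ge> 0" for m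
    using L[of m] pos[of m] pos[of n] by (simp add: x_def)
  have cx: "1 + x m \<le> c m" if "m \<ge> M" for m
  proof -
    define s t where "s = a m / a n" and "t = L m / a n"
    have st: "0 \<le> s" "s < 1" "0 \<le> t"
      using M0[of m] that pos[of m] pos[of n] L[of m] by (auto simp: s_def t_def M_def)
    have "0 \<le> s * t + s * s"
      using st by simp
    then have "(1 + (t + s)) * (1 - s) \<le> 1 + t"
      by (simp add: algebra_simps)
    then have "1 + (t + s) \<le> (1 + t) / \<bar>1 - s\<bar>"
      using st by (simp add: le_divide_eq)
    then show ?thesis
      by (simp add: c_def x_def s_def t_def add_divide_distrib)
  qed
  have "Bseq f"
    using conv convergent_imp_Bseq by (auto simp: f_def[abs_def] c_def)
  then obtain B where B: "\<And>N. f N \<le> B"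
    unfolding Bseq_def by (metis abs_le_D1 real_norm_def)
  have "(\<Sum>m<k. x (m + M)) \<le> B / f M" for k
  proof -
    have "(\<Sum>m<k. x (m + M)) = sum x {M..<M+k}"
      by (intro sum.reindex_bij_witness[of _ "\<lambda>m. m - M" "\<lambda>m. m + M"]) auto
    also have "\<dots> \<le> (\<Prod>m\<in>{M..<M+k}. 1 + x m)"
      using x0 by (intro sum_le_prod) auto
    also have "\<dots> \<le> (\<Prod>m\<in>{M..<M+k}. c m)"
      using x0 cx by (intro prod_mono) (auto intro: add_nonneg_nonneg)
    also have "\<dots> = f (M + k) / f M"
    proof -
      have "{..<M+k} - {n} = ({..<M} - {n}) \<union> {M..<M+k}"
        by (auto simp: M_def)
      then have "f (M + k) = f M * (\<Prod>m\<in>{M..<M+k}. c m)"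
        unfolding f_def by (simp add: prod.union_disjoint ivl_disj_int Int_Diff disjoint_iff)
      then show ?thesis
        using fpos[of M] by simp
    qed
    also have "\<dots> \<le> B / f M"
      using B fpos[of M] by (intro divide_right_mono) auto
    finally show ?thesis .
  qed
  then have "summable (\<lambda>m. x (m + M))"
    using x0 by (intro summableI_nonneg_bounded[where x = "B / f M"]) auto
  then have "summable x"
    by (simp add: summable_iff_shift)
  then have "summable (\<lambda>m. a n * x m)"
    by (rule summable_mult)
  then have "summable (\<lambda>m. L m + a m)"
    using pos[of n] by (simp add: x_def)
  then show "summable a" "summable L"
    by (rule summable_comparison_test'[where N = 0]; use L pos less_imp_le[OF pos] in simp)+
qed

lemma gain_defined_summable:
  fixes a l :: "nat \<Rightarrow> real" and b :: "nat \<Rightarrow> complex"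
  assumes a: "\<And>n. 0 < a n" "Bseq a" and l: "\<And>n. l n < 0"
    and gd: "gain_defined (\<lambda>n. complex_of_real (a n)) b (\<lambda>n. complex_of_real (l n))"
  shows "summable a" and "summable l"
proof -
  have inj_a: "inj a"
    using gd by (auto simp: gain_defined_def inj_def)
  have conv: "convergent (\<lambda>N. \<Prod>m\<in>{..<N} - {n}. (1 + - l m / a n) / \<bar>1 - a m / a n\<bar>)" for n
  proof -
    have "norm ((1 - complex_of_real (l m) / of_real (a n)) / (1 - of_real (a m) / of_real (a n)))
        = (1 + - l m / a n) / \<bar>1 - a m / a n\<bar>" for m
    proof -
      have "1 - l m / a n \<ge> 0"
        using l[of m] a(1)[of n] by (simp add: divide_nonpos_pos order_trans[of _ 0] less_imp_le)
      moreover have "norm ((1 - complex_of_real (l m) / of_real (a n)) / (1 - of_real (a m) / of_real (a n)))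
          = norm (complex_of_real ((1 - l m / a n) / (1 - a m / a n)))"
        by simp
      ultimately show ?thesis
        unfolding norm_of_real by simp
    qed
    then have "(\<lambda>N. \<Prod>m\<in>{..<N} - {n}. (1 + - l m / a n) / \<bar>1 - a m / a n\<bar>)
        = (\<lambda>N. norm (partial_product (\<lambda>n. complex_of_real (l n)) (\<lambda>n. complex_of_real (a n)) n N))"
      by (simp add: partial_product_def prod_norm[symmetric])
    then show ?thesis
      using convergent_norm[OF gd[unfolded gain_defined_def, THEN conjunct2, THEN conjunct2, THEN conjunct2, THEN conjunct2, THEN conjunct2, THEN spec[of _ n]]] by simp
  qed
  have l': "0 \<le> - l n" for n
    using l[of n] by simp
  have null: "a \<longlonglongrightarrow> 0"
    by (rule null_if_products_converge[OF a inj_a l' conv])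
  show "summable a"
    by (rule summable_if_products_converge(1)[OF a(1) inj_a null l' conv])
  have "summable (\<lambda>n. - l n)"
    by (rule summable_if_products_converge(2)[OF a(1) inj_a null l' conv])
  then show "summable l"
    using summable_minus[of "\<lambda>n. - l n"] by simp
qed

section \<open>Partial fractions\<close>

text \<open>Both sides have degree less than the number of nodes and agree at every node.\<close>

lemma lagrange_interpolation_poly:
  fixes x :: "'i \<Rightarrow> 'a :: field" and p :: "'a poly"
  assumes fin: "finite I" and inj: "inj_on x I" and deg: "degree p < card I"
  shows "p = (\<Sum>n\<in>I. smult (poly p (x n) / (\<Prod>m\<in>I-{n}. x n - x m)) (\<Prod>m\<in>I-{n}. [:- x m, 1:]))"
    (is "p = (\<Sum>n\<in>I. smult (?c n) (?q n))")
proof (rule poly_eqI_degree[of "x ` I"])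
  have card: "card (x ` I) = card I"
    using inj by (rule card_image)
  show "degree p < card (x ` I)"
    using deg card by simp
  have "card I > 0"
    using deg by simp
  have "degree (\<Sum>n\<in>I. smult (?c n) (?q n)) \<le> card I - 1"
  proof (rule degree_sum_le[OF fin])
    fix n assume "n \<in> I"
    have "degree (smult (?c n) (?q n)) \<le> degree (?q n)"
      by (rule degree_smult_le)
    also have "\<dots> = card I - 1"
      using fin \<open>n \<in> I\<close> by (subst degree_prod_sum_eq) auto
    finally show "degree (smult (?c n) (?q n)) \<le> card I - 1" .
  qed
  then show "degree (\<Sum>n\<in>I. smult (?c n) (?q n)) < card (x ` I)"
    using \<open>card I > 0\<close> card by linarith
next
  fix y assume "y \<in> x ` I"
  then obtain j where j: "j \<in> I" "y = x j"
    by auto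
  have "poly (\<Sum>n\<in>I. smult (?c n) (?q n)) y = (\<Sum>n\<in>I. ?c n * (\<Prod>m\<in>I-{n}. x j - x m))"
    by (simp add: poly_sum poly_prod j)
  also have "\<dots> = (\<Sum>n\<in>I. if n = j then poly p (x j) else 0)"
  proof (rule sum.cong)
    fix n assume n: "n \<in> I"
    show "?c n * (\<Prod>m\<in>I-{n}. x j - x m) = (if n = j then poly p (x j) else 0)"
    proof (cases "n = j")
      case True
      have "(\<Prod>m\<in>I-{j}. x j - x m) \<noteq> 0"
        using fin inj j by (auto simp: prod_zero_iff inj_on_def)
      then show ?thesis
        using True by simp
    next
      case False
      then have "(\<Prod>m\<in>I-{n}. x j - x m) = 0"
        using fin j by (intro prod_zero) auto
      then show ?thesis
        using False by simp
    qed
  qed simp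
  also have "\<dots> = poly p y"
    using fin j by (simp add: sum.delta)
  finally show "poly p y = poly (\<Sum>n\<in>I. smult (?c n) (?q n)) y"
    by simp
qed

lemma lagrange_top_coeff:
  fixes x :: "'i \<Rightarrow> 'a :: field" and p :: "'a poly"
  assumes fin: "finite I" and inj: "inj_on x I" and deg: "degree p < card I"
  shows "(\<Sum>n\<in>I. poly p (x n) / (\<Prod>m\<in>I-{n}. x n - x m)) = coeff p (card I - 1)"
proof -
  have "coeff (\<Prod>m\<in>I-{n}. [:- x m, 1:]) (card I - 1) = 1" if "n \<in> I" for n
  proof -
    have "degree (\<Prod>m\<in>I-{n}. [:- x m, 1:]) = card I - 1"
      using fin that by (subst degree_prod_sum_eq) auto
    then show ?thesis
      using lead_coeff_prod[of "\<lambda>m. [:- x m, 1:]" "I - {n}"] by simp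
  qed
  then show ?thesis
    by (subst (2) lagrange_interpolation_poly[OF assms]) (simp add: coeff_sum)
qed

lemma lagrange_partial_fractions:
  fixes x :: "'i \<Rightarrow> 'a :: field" and p :: "'a poly"
  assumes fin: "finite I" and inj: "inj_on x I" and deg: "degree p < card I"
    and z: "\<And>n. n \<in> I \<Longrightarrow> z \<noteq> x n"
  shows "(\<Sum>n\<in>I. poly p (x n) / (\<Prod>m\<in>I-{n}. x n - x m) / (z - x n)) = poly p z / (\<Prod>m\<in>I. z - x m)"
proof -
  define c where "c n = poly p (x n) / (\<Prod>m\<in>I-{n}. x n - x m)" for n
  have "poly p z = (\<Sum>n\<in>I. c n * (\<Prod>m\<in>I-{n}. z - x m))"
    by (subst lagrange_interpolation_poly[OF fin inj deg]) (simp add: poly_sum poly_prod c_def)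
  then have "poly p z / (\<Prod>m\<in>I. z - x m)
      = (\<Sum>n\<in>I. c n * (\<Prod>m\<in>I-{n}. z - x m) / (\<Prod>m\<in>I. z - x m))"
    by (simp add: sum_divide_distrib)
  also have "\<dots> = (\<Sum>n\<in>I. c n / (z - x n))"
  proof (rule sum.cong)
    fix n assume n: "n \<in> I"
    have "(\<Prod>m\<in>I. z - x m) = (z - x n) * (\<Prod>m\<in>I-{n}. z - x m)"
      using fin n by (rule prod.remove)
    moreover have "(\<Prod>m\<in>I-{n}. z - x m) \<noteq> 0"
      using fin z by (auto simp: prod_zero_iff)
    ultimately show "c n * (\<Prod>m\<in>I-{n}. z - x m) / (\<Prod>m\<in>I. z - x m) = c n / (z - x n)"
      by simp
  qed simp
  finally show ?thesis
    by (simp add: c_def)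
qed

text \<open>The residue at \<open>\<alpha> n\<close> of the rational function \<open>\<Prod>m<N. (z + \<beta> m) / (z - \<alpha> m)\<close>.\<close>

definition residue_weight :: "(nat \<Rightarrow> real) \<Rightarrow> (nat \<Rightarrow> real) \<Rightarrow> nat \<Rightarrow> nat \<Rightarrow> real" where
  "residue_weight \<alpha> \<beta> N n = (\<Prod>m<N. \<alpha> n + \<beta> m) / (\<Prod>m\<in>{..<N}-{n}. \<alpha> n - \<alpha> m)"

text \<open>For \<open>f z = (\<Prod>m<N. (z + \<beta> m) / (z - \<alpha> m))\<close>, these are \<open>f (- \<beta> j) = 0\<close> and the value of
  \<open>\<bar>f' (- \<beta> j)\<bar>\<close>, expressed by the residues of \<open>f\<close>. Dividing out the zero \<open>- \<beta> j\<close> leaves the numerator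
  \<open>p z = (\<Prod>m\<noteq>j. z + \<beta> m)\<close>, whose degree is below the number of nodes; the first sum is then
  the leading coefficient of \<open>p\<close>, and the second the partial fraction expansion of
  \<open>p z / (\<Prod>m<N. z - \<alpha> m)\<close> at \<open>z = - \<beta> j\<close> up to sign.\<close>

lemma residue_weight_sums:
  fixes \<alpha> \<beta> :: "nat \<Rightarrow> real"
  assumes \<alpha>: "\<And>n. 0 < \<alpha> n" and inj: "inj \<alpha>" and \<beta>: "\<And>n. 0 < \<beta> n" and "j < N"
  shows "(\<Sum>n<N. residue_weight \<alpha> \<beta> N n / (\<beta> j + \<alpha> n)) = 1"
    and "\<bar>\<Sum>n<N. residue_weight \<alpha> \<beta> N n / (\<beta> j + \<alpha> n)\<^sup>2\<bar>
      = (\<Prod>m\<in>{..<N}-{j}. \<bar>\<beta> j - \<beta> m\<bar>) / (\<Prod>m<N. \<beta> j + \<alpha> m)"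
proof -
  define p where "p = (\<Prod>m\<in>{..<N}-{j}. [:\<beta> m, 1:])"
  have deg: "degree p = N - 1"
    unfolding p_def using \<open>j < N\<close> by (subst degree_prod_sum_eq) auto
  have lead: "coeff p (N - 1) = 1"
    using lead_coeff_prod[of "\<lambda>m. [:\<beta> m, 1:]" "{..<N}-{j}"] deg by (simp add: p_def)
  have p: "poly p z = (\<Prod>m\<in>{..<N}-{j}. \<beta> m + z)" for z
    by (simp add: p_def poly_prod)
  have ps: "(\<beta> j + \<alpha> n) * poly p (\<alpha> n) = (\<Prod>m<N. \<alpha> n + \<beta> m)" for n
    using \<open>j < N\<close> unfolding p by (subst (2) prod.remove[of _ j]) (auto simp: add.commute)
  have w: "residue_weight \<alpha> \<beta> N n / (\<beta> j + \<alpha> n)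
      = poly p (\<alpha> n) / (\<Prod>m\<in>{..<N}-{n}. \<alpha> n - \<alpha> m)" for n
    using \<alpha>[of n] \<beta>[of j] unfolding residue_weight_def ps[symmetric] by simp
  have neq: "- \<beta> j \<noteq> \<alpha> n" for n
    using \<alpha>[of n] \<beta>[of j] by simp
  note lagrange = finite_lessThan[of N] inj_on_subset[OF inj subset_UNIV]
  show "(\<Sum>n<N. residue_weight \<alpha> \<beta> N n / (\<beta> j + \<alpha> n)) = 1"
    unfolding w using lagrange_top_coeff[OF lagrange, of p] deg lead \<open>j < N\<close> by simp
  have "residue_weight \<alpha> \<beta> N n / (\<beta> j + \<alpha> n)\<^sup>2
      = - (poly p (\<alpha> n) / (\<Prod>m\<in>{..<N}-{n}. \<alpha> n - \<alpha> m) / (- \<beta> j - \<alpha> n))" for n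
  proof -
    have "residue_weight \<alpha> \<beta> N n / (\<beta> j + \<alpha> n)\<^sup>2
        = residue_weight \<alpha> \<beta> N n / (\<beta> j + \<alpha> n) / (\<beta> j + \<alpha> n)"
      by (simp add: power2_eq_square)
    also have "\<dots> = poly p (\<alpha> n) / (\<Prod>m\<in>{..<N}-{n}. \<alpha> n - \<alpha> m) / - (- \<beta> j - \<alpha> n)"
      unfolding w by simp
    finally show ?thesis
      by (simp only: divide_minus_right)
  qed
  then have "(\<Sum>n<N. residue_weight \<alpha> \<beta> N n / (\<beta> j + \<alpha> n)\<^sup>2)
      = - (poly p (- \<beta> j) / (\<Prod>m<N. - \<beta> j - \<alpha> m))"
    using lagrange_partial_fractions[OF lagrange, of p "- \<beta> j"] deg \<open>j < N\<close> neq
    by (simp add: sum_negf)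
  then have "\<bar>\<Sum>n<N. residue_weight \<alpha> \<beta> N n / (\<beta> j + \<alpha> n)\<^sup>2\<bar>
      = (\<Prod>m\<in>{..<N}-{j}. \<bar>\<beta> m - \<beta> j\<bar>) / (\<Prod>m<N. \<bar>- \<beta> j - \<alpha> m\<bar>)"
    by (simp add: p abs_prod)
  moreover have "\<bar>- \<beta> j - \<alpha> m\<bar> = \<beta> j + \<alpha> m" for m
    using \<alpha>[of m] \<beta>[of j] by simp
  ultimately show "\<bar>\<Sum>n<N. residue_weight \<alpha> \<beta> N n / (\<beta> j + \<alpha> n)\<^sup>2\<bar>
      = (\<Prod>m\<in>{..<N}-{j}. \<bar>\<beta> j - \<beta> m\<bar>) / (\<Prod>m<N. \<beta> j + \<alpha> m)"
    by (simp add: abs_minus_commute)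
qed

text \<open>When the nodes decrease, each new node \<open>\<alpha> k\<close> lies below \<open>\<alpha> n\<close> and contributes the factor
  \<open>(\<alpha> n + \<beta> k) / (\<alpha> n - \<alpha> k) > 1\<close>. So the limits of the weights majorize the weights, which permits
  passing to the limit in the finite identities.\<close>

lemma residue_weight_mono:
  fixes \<alpha> \<beta> :: "nat \<Rightarrow> real"
  assumes \<alpha>: "\<And>n. 0 < \<alpha> n" and dec: "\<And>m n. m < n \<Longrightarrow> \<alpha> n < \<alpha> m" and \<beta>: "\<And>n. 0 < \<beta> n"
    and "n < N" "N \<le> M"
  shows "\<bar>residue_weight \<alpha> \<beta> N n\<bar> \<le> \<bar>residue_weight \<alpha> \<beta> M n\<bar>"
  using \<open>N \<le> M\<close>
proof (induction rule: dec_induct)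
  case (step k)
  have "{..<Suc k} - {n} = insert k ({..<k} - {n})"
    using step \<open>n < N\<close> by auto
  then have "residue_weight \<alpha> \<beta> (Suc k) n
      = residue_weight \<alpha> \<beta> k n * ((\<alpha> n + \<beta> k) / (\<alpha> n - \<alpha> k))"
    by (simp add: residue_weight_def mult.commute)
  moreover have "1 \<le> \<bar>(\<alpha> n + \<beta> k) / (\<alpha> n - \<alpha> k)\<bar>"
    using dec[of n k] \<alpha>[of k] \<beta>[of k] step \<open>n < N\<close> by (simp add: le_divide_eq)
  ultimately have "\<bar>residue_weight \<alpha> \<beta> k n\<bar> * 1 \<le> \<bar>residue_weight \<alpha> \<beta> (Suc k) n\<bar>"
    by (simp only: abs_mult) (intro mult_left_mono; simp)
  then show ?case
    using step by simp
qed simp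

text \<open>Tannery's theorem for triangular arrays.\<close>

lemma tendsto_sum_of_dominated:
  fixes f :: "nat \<Rightarrow> nat \<Rightarrow> complex"
  assumes lim: "\<And>n. (\<lambda>N. f N n) \<longlonglongrightarrow> g n" and le: "\<And>N n. n < N \<Longrightarrow> norm (f N n) \<le> M n"
    and "summable M"
  shows "(\<lambda>N. \<Sum>n<N. f N n) \<longlonglongrightarrow> (\<Sum>n. g n)"
proof -
  define a where "a n N = (if n < N then f N n else 0)" for n N
  have M0: "0 \<le> M n" for n
    using le[of n "Suc n"] norm_ge_zero order_trans by blast
  have "(\<lambda>N. suminf (\<lambda>n. a n N)) \<longlonglongrightarrow> suminf g"
  proof (rule conjunct2[OF conjunct2[OF tannerys_theorem]])
    show "(\<lambda>N. a n N) \<longlonglongrightarrow> g n" for n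
      by (rule Lim_transform_eventually[OF lim[of n]])
        (auto intro!: eventually_sequentiallyI[of "Suc n"] simp: a_def)
    show "\<forall>\<^sub>F (n, N) in at_top \<times>\<^sub>F sequentially. norm (a n N) \<le> M n"
      using le M0 by (intro always_eventually) (auto simp: a_def)
  qed (use \<open>summable M\<close> in simp_all)
  moreover have "suminf (\<lambda>n. a n N) = (\<Sum>n<N. f N n)" for N
    by (subst suminf_finite[of "{..<N}"]) (auto simp: a_def)
  ultimately show ?thesis
    by simp
qed

lemma residue_sums:
  fixes \<alpha> \<beta> :: "nat \<Rightarrow> real" and W :: "nat \<Rightarrow> complex"
  assumes \<alpha>: "\<And>n. 0 < \<alpha> n" and dec: "\<And>m n. m < n \<Longrightarrow> \<alpha> n < \<alpha> m" and \<beta>: "\<And>n. 0 < \<beta> n"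
    and W: "\<And>n. (\<lambda>N. of_real (residue_weight \<alpha> \<beta> N n)) \<longlonglongrightarrow> W n"
    and sm: "summable (\<lambda>n. norm (W n))"
  shows "(\<Sum>n. W n / of_real (\<beta> j + \<alpha> n)) = 1"
    and "(\<lambda>N. (\<Prod>m\<in>{..<N}-{j}. \<bar>\<beta> j - \<beta> m\<bar>) / (\<Prod>m<N. \<beta> j + \<alpha> m))
           \<longlonglongrightarrow> norm (\<Sum>n. W n / of_real ((\<beta> j + \<alpha> n)\<^sup>2))"
proof -
  have inj: "inj \<alpha>"
    by (rule injI) (metis dec less_irrefl linorder_neqE_nat)
  have le: "\<bar>residue_weight \<alpha> \<beta> N n\<bar> \<le> norm (W n)" if "n < N" for n N
  proof (rule tendsto_lowerbound)
    show "(\<lambda>M. norm (complex_of_real (residue_weight \<alpha> \<beta> M n))) \<longlonglongrightarrow> norm (W n)"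
      by (rule tendsto_norm[OF W])
    show "\<forall>\<^sub>F M in sequentially. \<bar>residue_weight \<alpha> \<beta> N n\<bar> \<le> norm (complex_of_real (residue_weight \<alpha> \<beta> M n))"
      using residue_weight_mono[of \<alpha> \<beta> n N, OF \<alpha> dec \<beta> that]
      by (auto intro!: eventually_sequentiallyI[of N])
  qed simp
  have lim: "(\<lambda>N. of_real (\<Sum>n<N. residue_weight \<alpha> \<beta> N n / h n)) \<longlonglongrightarrow> (\<Sum>n. W n / of_real (h n))"
    if "c > 0" "\<And>n. c \<le> h n" for h :: "nat \<Rightarrow> real" and c
  proof -
    have "(\<lambda>N. \<Sum>n<N. complex_of_real (residue_weight \<alpha> \<beta> N n) / of_real (h n))
        \<longlonglongrightarrow> (\<Sum>n. W n / of_real (h n))"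
    proof (rule tendsto_sum_of_dominated)
      show "(\<lambda>N. complex_of_real (residue_weight \<alpha> \<beta> N n) / of_real (h n)) \<longlonglongrightarrow> W n / of_real (h n)" for n
        using that(1) that(2)[of n] by (intro tendsto_divide W tendsto_const) auto
      show "summable (\<lambda>n. norm (W n) / c)"
        using sm by (rule summable_divide)
      show "norm (complex_of_real (residue_weight \<alpha> \<beta> N n) / of_real (h n)) \<le> norm (W n) / c"
        if "n < N" for N n
        using le[OF that] \<open>c > 0\<close> \<open>\<And>n. c \<le> h n\<close>[of n]
        by (auto simp: norm_divide intro!: frac_le)
    qed
    then show ?thesis
      by simp
  qed
  have 1: "\<beta> j \<le> \<beta> j + \<alpha> n" for n
    using \<alpha>[of n] by simp
  then have 2: "(\<beta> j)\<^sup>2 \<le> (\<beta> j + \<alpha> n)\<^sup>2" for n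
    using \<beta>[of j] by (intro power_mono) auto
  have "(\<lambda>N. of_real (\<Sum>n<N. residue_weight \<alpha> \<beta> N n / (\<beta> j + \<alpha> n))) \<longlonglongrightarrow> (1::complex)"
  proof (intro tendsto_eventually eventually_sequentiallyI)
    fix N assume "Suc j \<le> N"
    then show "of_real (\<Sum>n<N. residue_weight \<alpha> \<beta> N n / (\<beta> j + \<alpha> n)) = (1::complex)"
      by (subst residue_weight_sums(1)[OF \<alpha> inj \<beta>]) auto
  qed
  then show "(\<Sum>n. W n / of_real (\<beta> j + \<alpha> n)) = 1"
    using lim[OF \<beta> 1] by (rule LIMSEQ_unique[rotated])
  have "(\<lambda>N. norm (complex_of_real (\<Sum>n<N. residue_weight \<alpha> \<beta> N n / (\<beta> j + \<alpha> n)\<^sup>2)))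
     \<longlonglongrightarrow> norm (\<Sum>n. W n / of_real ((\<beta> j + \<alpha> n)\<^sup>2))"
    by (intro tendsto_norm lim[OF _ 2] zero_less_power \<beta>)
  then show "(\<lambda>N. (\<Prod>m\<in>{..<N}-{j}. \<bar>\<beta> j - \<beta> m\<bar>) / (\<Prod>m<N. \<beta> j + \<alpha> m))
           \<longlonglongrightarrow> norm (\<Sum>n. W n / of_real ((\<beta> j + \<alpha> n)\<^sup>2))"
  proof (rule Lim_transform_eventually, intro eventually_sequentiallyI)
    fix N assume "Suc j \<le> N"
    then show "norm (complex_of_real (\<Sum>n<N. residue_weight \<alpha> \<beta> N n / (\<beta> j + \<alpha> n)\<^sup>2))
        = (\<Prod>m\<in>{..<N}-{j}. \<bar>\<beta> j - \<beta> m\<bar>) / (\<Prod>m<N. \<beta> j + \<alpha> m)"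
      unfolding norm_of_real by (subst residue_weight_sums(2)[OF \<alpha> inj \<beta>]) auto
  qed
qed

text \<open>The gains are defined by products in which \<open>l m\<close> and \<open>a m\<close> share a factor. Numerators and
  denominators converge absolutely on their own, so the two sequences may be rearranged by different
  permutations without changing the limit.\<close>

lemma residue_weight_tendsto_gain:
  fixes a l :: "nat \<Rightarrow> real" and b :: "nat \<Rightarrow> complex"
  assumes a: "\<And>n. 0 < a n" and inj: "inj a" and l: "\<And>n. l n < 0"
    and sums: "summable a" "summable l"
    and "bij \<sigma>" "bij \<tau>" and b: "b (\<sigma> i) \<noteq> 0"
  shows "(\<lambda>N. of_real (residue_weight (\<lambda>n. a (\<sigma> n)) (\<lambda>n. - l (\<tau> n)) N i)) \<longlonglongrightarrow>
    - (gain (\<lambda>n. of_real (a n)) b (\<lambda>n. of_real (l n)) (\<sigma> i) * b (\<sigma> i))"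
proof -
  define n where "n = \<sigma> i"
  \<comment> \<open>The denominators skip the index \<open>n\<close>; setting \<open>v n = 1\<close> makes the skipping automatic.\<close>
  define u v :: "nat \<Rightarrow> complex"
    where "u m = of_real (1 - l m / a n)" and "v m = (if m = n then 1 else of_real (1 - a m / a n))" for m
  define U V where "U = exp (\<Sum>\<^sub>\<infinity>m. Ln (u m))" and "V = exp (\<Sum>\<^sub>\<infinity>m. Ln (v m))"
  have an: "a n > 0"
    by (rule a)
  have u: "u m \<noteq> 0" for m
  proof -
    have "1 - l m / a n > 0"
      using an l[of m] by (simp add: divide_neg_pos less_trans[of _ 0])
    then show ?thesis
      unfolding u_def of_real_eq_0_iff by linarith
  qed
  have ne: "1 - a m / a n \<noteq> 0" if "m \<noteq> n" for m
    using that inj an by (auto simp: inj_def)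
  then have v: "v m \<noteq> 0" for m
    unfolding v_def by (auto simp del: of_real_diff of_real_divide)
  have su: "summable (\<lambda>m. norm (u m - 1))"
  proof -
    have "norm (u m - 1) = - (l m / a n)" for m
      using an l[of m] by (simp add: u_def norm_divide)
    then show ?thesis
      using sums(2) by (simp add: summable_minus summable_divide)
  qed
  have sv: "summable (\<lambda>m. norm (v m - 1))"
  proof (rule summable_comparison_test')
    show "summable (\<lambda>m. a m / a n)"
      using sums(1) by (rule summable_divide)
    show "norm (norm (v m - 1)) \<le> a m / a n" for m
      using an a[of m] by (simp add: v_def norm_divide)
  qed
  have lim: "(\<lambda>N. (\<Prod>m<N. u (\<tau>' m)) / (\<Prod>m<N. v (\<sigma>' m))) \<longlonglongrightarrow> U / V"
    if "bij \<sigma>'" "bij \<tau>'" for \<sigma>' \<tau>'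
    unfolding U_def V_def by (intro tendsto_divide tendsto_prod_permuted u v su sv that) auto
  have "partial_product (\<lambda>n. of_real (l n)) (\<lambda>n. of_real (a n)) n N
      = (\<Prod>m<N. u (id m)) / (\<Prod>m<N. v (id m)) / u n" if "N > n" for N
  proof -
    have "(\<Prod>m<N. u m) = u n * (\<Prod>m\<in>{..<N}-{n}. u m)" "(\<Prod>m<N. v m) = v n * (\<Prod>m\<in>{..<N}-{n}. v m)"
      using that by (auto intro!: prod.remove)
    moreover have "(\<Prod>m\<in>{..<N}-{n}. v m) = (\<Prod>m\<in>{..<N}-{n}. of_real (1 - a m / a n))"
      by (intro prod.cong) (auto simp: v_def)
    ultimately show ?thesis
      using u[of n] by (simp add: partial_product_def prod_dividef u_def v_def)
  qed
  then have "(\<lambda>N. partial_product (\<lambda>n. of_real (l n)) (\<lambda>n. of_real (a n)) n N) \<longlonglongrightarrow> U / V / u n"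
    using tendsto_divide[OF lim[OF bij_id bij_id] tendsto_const u[of n]]
    by (elim Lim_transform_eventually) (auto intro!: eventually_sequentiallyI[of "Suc n"])
  then have "pi_lim (\<lambda>n. of_real (l n)) (\<lambda>n. of_real (a n)) n = U / V / u n"
    unfolding pi_lim_def by (rule limI)
  moreover have "of_real (a n) * u n = of_real (a n) - of_real (l n)"
    using an by (simp add: u_def algebra_simps)
  moreover have "- (gain (\<lambda>n. of_real (a n)) b (\<lambda>n. of_real (l n)) n * b n)
      = (of_real (a n) - of_real (l n)) * pi_lim (\<lambda>n. of_real (l n)) (\<lambda>n. of_real (a n)) n"
    using b by (simp add: gain_def n_def)
  ultimately have gain: "- (gain (\<lambda>n. of_real (a n)) b (\<lambda>n. of_real (l n)) n * b n) = of_real (a n) * (U / V)"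
    using u[of n] by (metis (no_types, lifting) mult.assoc nonzero_mult_div_cancel_left times_divide_eq_right)
  have "of_real (a n) * ((\<Prod>m<N. u (\<tau> m)) / (\<Prod>m<N. v (\<sigma> m)))
      = of_real (residue_weight (\<lambda>n. a (\<sigma> n)) (\<lambda>n. - l (\<tau> n)) N i)" if "N > i" for N
  proof -
    have "a n - l m = a n * (1 - l m / a n)" "a n - a m = a n * (1 - a m / a n)" for m
      using an by (auto simp: algebra_simps)
    then have "complex_of_real (residue_weight (\<lambda>n. a (\<sigma> n)) (\<lambda>n. - l (\<tau> n)) N i)
        = (\<Prod>m<N. of_real (a n) * u (\<tau> m)) / (\<Prod>m\<in>{..<N}-{i}. of_real (a n) * of_real (1 - a (\<sigma> m) / a n))"
      by (simp add: residue_weight_def n_def[symmetric] u_def)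
    also have "(\<Prod>m\<in>{..<N}-{i}. complex_of_real (a n) * of_real (1 - a (\<sigma> m) / a n))
        = (\<Prod>m\<in>{..<N}-{i}. of_real (a n) * v (\<sigma> m))"
      using \<open>bij \<sigma>\<close> by (intro prod.cong) (auto simp: v_def n_def dest!: bij_is_inj injD)
    also have "\<dots> = of_real (a n) ^ (N - 1) * (\<Prod>m\<in>{..<N}-{i}. v (\<sigma> m))"
      using that by (simp add: prod.distrib)
    also have "(\<Prod>m\<in>{..<N}-{i}. v (\<sigma> m)) = (\<Prod>m<N. v (\<sigma> m))"
      using that by (subst (2) prod.remove[of _ i]) (auto simp: v_def n_def)
    also have "(\<Prod>m<N. of_real (a n) * u (\<tau> m)) = of_real (a n) ^ (N - 1) * (of_real (a n) * (\<Prod>m<N. u (\<tau> m)))"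
      using that by (simp add: prod.distrib power_Suc2[symmetric] mult.assoc[symmetric] del: power_Suc)
    finally show ?thesis
      using an by simp
  qed
  then have "eventually (\<lambda>N. of_real (a n) * ((\<Prod>m<N. u (\<tau> m)) / (\<Prod>m<N. v (\<sigma> m)))
      = of_real (residue_weight (\<lambda>n. a (\<sigma> n)) (\<lambda>n. - l (\<tau> n)) N i)) sequentially"
    by (intro eventually_sequentiallyI[of "Suc i"]) auto
  then show ?thesis
    unfolding n_def[symmetric] gain
    by (rule Lim_transform_eventually[OF tendsto_mult[OF tendsto_const lim[OF \<open>bij \<sigma>\<close> \<open>bij \<tau>\<close>]]])
qed

text \<open>For a finite number of nodes, the residue at \<open>\<alpha> i\<close> divided by the derivative at \<open>- \<beta> i\<close> and by
  \<open>(\<alpha> i + \<beta> i)\<^sup>2\<close> is, up to sign, the product of the quotients \<open>S m / D m\<close> with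
  \<open>S m = (\<alpha> i + \<beta> m) (\<beta> i + \<alpha> m)\<close> and \<open>D m = (\<alpha> i - \<alpha> m) (\<beta> i - \<beta> m)\<close>. Because
  \<open>S m - D m = (\<alpha> i + \<beta> i) (\<alpha> m + \<beta> m) > 0\<close> and both listings decrease, each quotient exceeds \<open>1\<close>.
  So in the limit the product is at least \<open>1\<close>, and at least as large as any single quotient; the
  bounds are multiplied out because the limit \<open>G\<close> of the derivatives may vanish.\<close>

lemma residue_ratio_bounds:
  fixes \<alpha> \<beta> :: "nat \<Rightarrow> real" and W :: "nat \<Rightarrow> complex"
  assumes \<alpha>: "\<And>n. 0 < \<alpha> n" and dec\<alpha>: "\<And>m n. m < n \<Longrightarrow> \<alpha> n < \<alpha> m"
    and \<beta>: "\<And>n. 0 < \<beta> n" and dec\<beta>: "\<And>m n. m < n \<Longrightarrow> \<beta> n < \<beta> m"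
    and W: "(\<lambda>N. of_real (residue_weight \<alpha> \<beta> N i)) \<longlonglongrightarrow> W i"
    and G: "(\<lambda>N. (\<Prod>m\<in>{..<N}-{i}. \<bar>\<beta> i - \<beta> m\<bar>) / (\<Prod>m<N. \<beta> i + \<alpha> m)) \<longlonglongrightarrow> G"
  shows "G * (\<alpha> i + \<beta> i)\<^sup>2 \<le> norm (W i)"
    and "m \<noteq> i \<Longrightarrow> (\<alpha> i + \<beta> m) * (\<beta> i + \<alpha> m) * (G * (\<alpha> i + \<beta> i)\<^sup>2)
           \<le> (\<alpha> i - \<alpha> m) * (\<beta> i - \<beta> m) * norm (W i)"
proof -
  define GN where "GN N = (\<Prod>m\<in>{..<N}-{i}. \<bar>\<beta> i - \<beta> m\<bar>) / (\<Prod>m<N. \<beta> i + \<alpha> m)" for N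
  define S D where "S m = (\<alpha> i + \<beta> m) * (\<beta> i + \<alpha> m)" and "D m = (\<alpha> i - \<alpha> m) * (\<beta> i - \<beta> m)" for m
  define R where "R N = (\<Prod>m\<in>{..<N}-{i}. S m / D m)" for N
  have D: "D m > 0" if "m \<noteq> i" for m
    using that dec\<alpha>[of i m] dec\<alpha>[of m i] dec\<beta>[of i m] dec\<beta>[of m i]
    by (cases "m < i") (auto simp: D_def zero_less_mult_iff)
  have SD: "D m \<le> S m" for m
  proof -
    have "S m - D m = (\<alpha> i + \<beta> i) * (\<alpha> m + \<beta> m)"
      by (simp add: S_def D_def algebra_simps)
    moreover have "\<dots> \<ge> 0"
      using \<alpha>[of i] \<alpha>[of m] \<beta>[of i] \<beta>[of m] by simp
    ultimately show ?thesis
      by linarith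
  qed
  have ratio: "1 \<le> S m / D m" if "m \<noteq> i" for m
    using D[OF that] SD[of m] by simp
  have split: "\<bar>residue_weight \<alpha> \<beta> N i\<bar> = R N * (GN N * (\<alpha> i + \<beta> i)\<^sup>2)" if "i < N" for N
  proof -
    have "\<bar>\<alpha> i + \<beta> m\<bar> = \<alpha> i + \<beta> m" for m
      using \<alpha>[of i] \<beta>[of m] by simp
    then have "(\<Prod>m<N. \<bar>\<alpha> i + \<beta> m\<bar>) = (\<alpha> i + \<beta> i) * (\<Prod>m\<in>{..<N}-{i}. \<alpha> i + \<beta> m)"
      using that by (subst prod.remove[of _ i]) simp_all
    moreover have "(\<Prod>m<N. \<beta> i + \<alpha> m) = (\<alpha> i + \<beta> i) * (\<Prod>m\<in>{..<N}-{i}. \<beta> i + \<alpha> m)"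
      using that by (subst prod.remove[of _ i]) (auto simp: add.commute)
    moreover have "R N = (\<Prod>m\<in>{..<N}-{i}. \<alpha> i + \<beta> m) * (\<Prod>m\<in>{..<N}-{i}. \<beta> i + \<alpha> m)
        / ((\<Prod>m\<in>{..<N}-{i}. \<bar>\<alpha> i - \<alpha> m\<bar>) * (\<Prod>m\<in>{..<N}-{i}. \<bar>\<beta> i - \<beta> m\<bar>))"
    proof -
      have "R N = (\<Prod>m\<in>{..<N}-{i}. S m / (\<bar>\<alpha> i - \<alpha> m\<bar> * \<bar>\<beta> i - \<beta> m\<bar>))"
        unfolding R_def
      proof (rule prod.cong)
        fix m assume "m \<in> {..<N} - {i}"
        then have "D m = \<bar>D m\<bar>"
          using D[of m] by simp
        then show "S m / D m = S m / (\<bar>\<alpha> i - \<alpha> m\<bar> * \<bar>\<beta> i - \<beta> m\<bar>)"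
          by (simp add: D_def abs_mult)
      qed simp
      then show ?thesis
        by (simp add: S_def prod_dividef prod.distrib)
    qed
    moreover have "(\<Prod>m\<in>{..<N}-{i}. \<bar>\<beta> i - \<beta> m\<bar>) \<noteq> 0"
      using D by (force simp: prod_zero_iff D_def)
    moreover have "(\<Prod>m\<in>{..<N}-{i}. \<beta> i + \<alpha> m) > 0"
      using \<alpha> \<beta> by (intro prod_pos) (auto simp: add_pos_pos)
    moreover have "\<alpha> i + \<beta> i > 0"
      using \<alpha>[of i] \<beta>[of i] by simp
    ultimately show ?thesis
      by (simp add: residue_weight_def GN_def abs_prod power2_eq_square del: prod_zero_iff)
  qed
  have GN: "0 \<le> GN N * (\<alpha> i + \<beta> i)\<^sup>2" for N
    using \<alpha> \<beta> unfolding GN_def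
    by (intro mult_nonneg_nonneg divide_nonneg_nonneg prod_nonneg) (auto simp: less_imp_le add_pos_pos)
  have limW: "(\<lambda>N. \<bar>residue_weight \<alpha> \<beta> N i\<bar>) \<longlonglongrightarrow> norm (W i)"
    using tendsto_norm[OF W] by simp
  have limG: "(\<lambda>N. c * (GN N * (\<alpha> i + \<beta> i)\<^sup>2)) \<longlonglongrightarrow> c * (G * (\<alpha> i + \<beta> i)\<^sup>2)" for c
    unfolding GN_def by (intro tendsto_intros G)
  have key: "c * (G * (\<alpha> i + \<beta> i)\<^sup>2) \<le> norm (W i)" if "\<And>N. N \<ge> N0 \<Longrightarrow> c \<le> R N" for c N0
  proof (rule tendsto_le[OF _ limW limG])
    show "\<forall>\<^sub>F N in sequentially. c * (GN N * (\<alpha> i + \<beta> i)\<^sup>2) \<le> \<bar>residue_weight \<alpha> \<beta> N i\<bar>"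
    proof (rule eventually_sequentiallyI[of "max N0 (Suc i)"])
      fix N assume N: "max N0 (Suc i) \<le> N"
      then show "c * (GN N * (\<alpha> i + \<beta> i)\<^sup>2) \<le> \<bar>residue_weight \<alpha> \<beta> N i\<bar>"
        by (subst split) (auto intro!: mult_right_mono[OF that GN])
    qed
  qed simp
  show "G * (\<alpha> i + \<beta> i)\<^sup>2 \<le> norm (W i)"
  proof -
    have "1 \<le> R N" for N
      unfolding R_def using ratio by (intro prod_ge_1) auto
    then show ?thesis
      using key[of 0 1] by simp
  qed
  show "(\<alpha> i + \<beta> m) * (\<beta> i + \<alpha> m) * (G * (\<alpha> i + \<beta> i)\<^sup>2)
           \<le> (\<alpha> i - \<alpha> m) * (\<beta> i - \<beta> m) * norm (W i)" if "m \<noteq> i"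
  proof -
    have "S m / D m \<le> R N" if "N \<ge> Suc m" for N
    proof -
      have "R N = S m / D m * (\<Prod>m\<in>{..<N}-{i}-{m}. S m / D m)"
        unfolding R_def using that \<open>m \<noteq> i\<close> by (intro prod.remove) auto
      moreover have "1 \<le> (\<Prod>m\<in>{..<N}-{i}-{m}. S m / D m)"
        using ratio by (intro prod_ge_1) auto
      moreover have "0 \<le> S m / D m"
        using ratio[OF \<open>m \<noteq> i\<close>] by linarith
      ultimately show ?thesis
        using mult_left_mono[of 1 "\<Prod>m\<in>{..<N}-{i}-{m}. S m / D m" "S m / D m"] by simp
    qed
    then have "S m / D m * (G * (\<alpha> i + \<beta> i)\<^sup>2) \<le> norm (W i)"
      by (rule key)
    then show ?thesis
      using D[OF that] unfolding S_def[symmetric] D_def[symmetric] by (simp add: field_simps)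
  qed
qed

section \<open>Sequence spaces\<close>

lemma finite_support_in_seqs:
  assumes "finite {n. x n \<noteq> 0}"
  shows "x \<in> seqs X"
proof -
  obtain N where N: "\<And>n. n \<ge> N \<Longrightarrow> x n = 0"
    using assms unfolding finite_nat_set_iff_bounded by (auto simp: not_less[symmetric])
  have null: "x \<longlonglongrightarrow> 0"
    using N by (intro tendsto_eventually eventually_sequentiallyI)
  show ?thesis
  proof (cases X)
    case (Ell p)
    have "summable (\<lambda>n. cmod (x n) powr p)"
      using assms by (intro summable_finite[of "{n. x n \<noteq> 0}"]) auto
    then show ?thesis
      using Ell by simp
  qed (use null convergentI convergent_imp_Bseq in auto)
qed

lemma convergent_mult_in_seqs:
  assumes X: "banach_seq_space X" and m: "convergent m" and x: "x \<in> seqs X"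
  shows "(\<lambda>n. m n * x n) \<in> seqs X"
proof -
  have bdd: "Bseq m"
    using m by (rule convergent_imp_Bseq)
  show ?thesis
  proof (cases X)
    case (Ell p)
    obtain B where B: "B > 0" "\<And>n. cmod (m n) \<le> B"
      using bdd by (auto simp: Bseq_def)
    have "summable (\<lambda>n. cmod (m n * x n) powr p)"
    proof (rule summable_comparison_test')
      show "summable (\<lambda>n. B powr p * cmod (x n) powr p)"
        using x Ell by (intro summable_mult) simp
      show "norm (cmod (m n * x n) powr p) \<le> B powr p * cmod (x n) powr p" for n
        using B X Ell by (auto simp: norm_mult powr_mult intro!: mult_right_mono powr_mono2)
    qed
    then show ?thesis
      using Ell by simp
  next
    case Ell_inf
    then show ?thesis
      using bdd x by (auto intro: Bseq_mult)
  next
    case Conv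
    then show ?thesis
      using m x by (auto intro: convergent_mult)
  next
    case Null
    obtain c where "m \<longlonglongrightarrow> c"
      using m by (auto simp: convergent_def)
    then have "(\<lambda>n. m n * x n) \<longlonglongrightarrow> c * 0"
      using x Null by (intro tendsto_mult) auto
    then show ?thesis
      using Null by simp
  qed
qed

lemma seqs_scale:
  assumes "banach_seq_space X" "x \<in> seqs X"
  shows "(\<lambda>n. c * x n) \<in> seqs X"
  using convergent_mult_in_seqs[OF assms(1) convergent_const assms(2)] .

lemma seqs_bdd_above:
  assumes "x \<in> seqs X" "\<And>p. X \<noteq> Ell p"
  shows "bdd_above (range (\<lambda>n. cmod (x n)))"
proof -
  have "Bseq x"
    using assms by (cases X) (auto simp: convergent_imp_Bseq convergentI)
  then show ?thesis
    by (auto simp: Bseq_def bdd_above_def)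
qed

lemma seq_norm_not_Ell:
  "(\<And>p. X \<noteq> Ell p) \<Longrightarrow> seq_norm X x = (SUP n. cmod (x n))"
  by (cases X) auto

lemma sum_powr_le_seq_norm:
  assumes "x \<in> seqs (Ell p)" "1 \<le> p" "finite F"
  shows "(\<Sum>n\<in>F. cmod (x n) powr p) \<le> seq_norm (Ell p) x powr p"
proof -
  have "(\<Sum>n\<in>F. cmod (x n) powr p) \<le> (\<Sum>n. cmod (x n) powr p)"
    using assms by (intro sum_le_suminf) auto
  also have "\<dots> = seq_norm (Ell p) x powr p"
    using assms by (simp add: powr_powr suminf_nonneg)
  finally show ?thesis .
qed

lemma coordinate_le_seq_norm:
  assumes X: "banach_seq_space X" and x: "x \<in> seqs X"
  shows "cmod (x n) \<le> seq_norm X x"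
proof (cases "\<exists>p. X = Ell p")
  case True
  then obtain p where p: "X = Ell p" "1 \<le> p"
    using X by auto
  have le: "cmod (x n) powr p \<le> seq_norm X x powr p"
    using sum_powr_le_seq_norm[of x p "{n}"] x p by simp
  have "(cmod (x n) powr p) powr (1 / p) \<le> (seq_norm X x powr p) powr (1 / p)"
    by (rule powr_mono2[OF _ _ le]) (use p in auto)
  moreover have "0 \<le> seq_norm X x"
    using p by simp
  ultimately show ?thesis
    using p by (simp only: powr_powr) simp
next
  case False
  then show ?thesis
    using seqs_bdd_above[OF x] by (auto simp: seq_norm_not_Ell intro: cSUP_upper)
qed

lemma seq_norm_mono:
  assumes X: "banach_seq_space X" and y: "y \<in> seqs X" and le: "\<And>n. cmod (x n) \<le> cmod (y n)"
  shows "seq_norm X x \<le> seq_norm X y"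
proof (cases "\<exists>p. X = Ell p")
  case True
  then obtain p where p: "X = Ell p" "1 \<le> p"
    using X by auto
  have powr_le: "cmod (x n) powr p \<le> cmod (y n) powr p" for n
    using le p by (intro powr_mono2) auto
  have sy: "summable (\<lambda>n. cmod (y n) powr p)"
    using y p by simp
  have sx: "summable (\<lambda>n. cmod (x n) powr p)"
    using powr_le by (intro summable_comparison_test'[OF sy, of 0]) simp
  show ?thesis
    using p suminf_le[OF powr_le sx sy] by (auto intro!: powr_mono2 suminf_nonneg sx)
next
  case False
  then show ?thesis
    using seqs_bdd_above[OF y] le by (auto simp: seq_norm_not_Ell intro!: cSUP_mono)
qed

definition unit_seq :: "nat \<Rightarrow> nat \<Rightarrow> complex" where
  "unit_seq j n = (if n = j then 1 else 0)"

lemma unit_seq_in_seqs: "unit_seq j \<in> seqs X"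
  by (rule finite_support_in_seqs) (simp add: unit_seq_def)

lemma seq_norm_unit_seq: "seq_norm X (unit_seq j) \<le> 1"
proof (cases "\<exists>p. X = Ell p")
  case True
  then obtain p where p: "X = Ell p"
    by auto
  have "(\<Sum>n. cmod (unit_seq j n) powr p) = (\<Sum>n\<in>{j}. cmod (unit_seq j n) powr p)"
    by (rule suminf_finite) (auto simp: unit_seq_def)
  then show ?thesis
    using p by (simp add: unit_seq_def)
next
  case False
  then show ?thesis
    by (auto simp: seq_norm_not_Ell unit_seq_def intro!: cSUP_least)
qed

lemma bounded_op_bound:
  assumes X: "banach_seq_space X" and T: "bounded_op X T"
  obtains C where "C > 0" "\<And>x. x \<in> seqs X \<Longrightarrow> seq_norm X (T x) \<le> C * seq_norm X x"
proof -
  obtain C where C: "\<And>x. x \<in> seqs X \<Longrightarrow> seq_norm X (T x) \<le> C * seq_norm X x"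
    using T unfolding bounded_op_def by blast
  have "seq_norm X (T x) \<le> max C 1 * seq_norm X x" if "x \<in> seqs X" for x
  proof -
    have "0 \<le> seq_norm X x"
      using coordinate_le_seq_norm[OF X that, of 0] norm_ge_zero order_trans by blast
    then have "C * seq_norm X x \<le> max C 1 * seq_norm X x"
      by (intro mult_right_mono) auto
    then show ?thesis
      using C[OF that] by linarith
  qed
  then show thesis
    using that[of "max C 1"] by auto
qed

lemma bounded_op_finite_sum:
  assumes X: "banach_seq_space X" and T: "bounded_op X T" and "finite F"
  shows "T (\<lambda>n. if n \<in> F then c n else 0) = (\<lambda>m. \<Sum>j\<in>F. c j * T (unit_seq j) m)"
  using \<open>finite F\<close>
proof induction
  case empty
  have "T (\<lambda>n. 0 * unit_seq 0 n) = (\<lambda>n. 0 * T (unit_seq 0) n)"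
    using T unit_seq_in_seqs unfolding bounded_op_def by blast
  then show ?case
    by simp
next
  case (insert j F)
  define x where "x n = (if n \<in> F then c n else 0)" for n
  have x: "x \<in> seqs X"
    using insert.hyps(1) by (intro finite_support_in_seqs) (auto simp: x_def intro: rev_finite_subset)
  have split: "(\<lambda>n. if n \<in> insert j F then c n else 0) = (\<lambda>n. x n + c j * unit_seq j n)"
    using insert.hyps by (auto simp: x_def unit_seq_def)
  have add: "\<forall>x\<in>seqs X. \<forall>y\<in>seqs X. T (\<lambda>n. x n + y n) = (\<lambda>n. T x n + T y n)"
    using T by (simp add: bounded_op_def)
  have "T (\<lambda>n. x n + c j * unit_seq j n) = (\<lambda>n. T x n + T (\<lambda>n. c j * unit_seq j n) n)"
    by (rule bspec[OF bspec[OF add x] seqs_scale[OF X unit_seq_in_seqs]])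
  also have "T (\<lambda>n. c j * unit_seq j n) = (\<lambda>n. c j * T (unit_seq j) n)"
    using T unit_seq_in_seqs unfolding bounded_op_def by blast
  finally have "T (\<lambda>n. x n + c j * unit_seq j n) = (\<lambda>n. T x n + c j * T (unit_seq j) n)" .
  moreover have "T x = (\<lambda>m. \<Sum>j\<in>F. c j * T (unit_seq j) m)"
    using insert.IH by (simp add: x_def[abs_def])
  ultimately show ?case
    using insert.hyps by (simp only: split) (simp add: add.commute)
qed

text \<open>Under the sup norm, finitely supported vectors with unimodular entries have norm \<open>1\<close>; the one
  that rotates all entries of a row to the positive axis produces the row sum.\<close>

lemma row_sums_bounded:
  assumes X: "banach_seq_space X" "\<And>p. X \<noteq> Ell p" and P: "bounded_op X P"
    and C: "C \<ge> 0" "\<And>x. x \<in> seqs X \<Longrightarrow> seq_norm X (P x) \<le> C * seq_norm X x" and "finite S"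
  shows "(\<Sum>j\<in>S. cmod (P (unit_seq j) n)) \<le> C"
proof -
  define x where "x j = (if j \<in> S then cnj (sgn (P (unit_seq j) n)) else 0)" for j
  have x: "x \<in> seqs X"
    using \<open>finite S\<close> by (intro finite_support_in_seqs) (auto simp: x_def intro: rev_finite_subset)
  have "seq_norm X x \<le> 1"
    unfolding seq_norm_not_Ell[OF X(2)] by (rule cSUP_least) (auto simp: x_def norm_sgn)
  then have "seq_norm X (P x) \<le> C"
    using C(2)[OF x] mult_left_mono[of "seq_norm X x" 1 C] C(1) by linarith
  moreover have "P x \<in> seqs X"
    using P x by (auto simp: bounded_op_def)
  ultimately have "cmod (P x n) \<le> C"
    using coordinate_le_seq_norm[OF X(1), of "P x" n] by linarith
  moreover have "P x n = of_real (\<Sum>j\<in>S. cmod (P (unit_seq j) n))"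
  proof -
    have "cnj (sgn w) * w = of_real (cmod w)" for w
      by (cases "w = 0") (auto simp: sgn_eq complex_norm_square[symmetric] power2_eq_square mult.commute)
    then show ?thesis
      unfolding x_def using bounded_op_finite_sum[OF X(1) P \<open>finite S\<close>] by simp
  qed
  ultimately show ?thesis
    by (simp add: sum_nonneg flip: of_real_sum)
qed

text \<open>The functional is tested on truncations of \<open>b\<close> with rotated entries. Truncation is needed for the
  space \<open>c\<close>, which is not closed under rotating the entries of its members.\<close>

lemma dual_product_summable:
  assumes X: "banach_seq_space X" and k: "in_dual X k" and b: "b \<in> seqs X"
  shows "summable (\<lambda>n. cmod (k n * b n))"
proof -
  obtain C where C: "\<And>x. x \<in> seqs X \<Longrightarrow> cmod (functional k x) \<le> C * seq_norm X x"
    using k by (auto simp: in_dual_def)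
  have "(\<Sum>n<N. cmod (k n * b n)) \<le> \<bar>C\<bar> * seq_norm X b" for N
  proof -
    define x where "x n = (if n < N then b n * cnj (sgn (k n * b n)) else 0)" for n
    have x: "x \<in> seqs X"
      by (rule finite_support_in_seqs) (auto simp: x_def intro: finite_subset[of _ "{..<N}"])
    have "cmod (x n) \<le> cmod (b n)" for n
      by (simp add: x_def norm_mult norm_sgn)
    then have norm_x: "seq_norm X x \<le> seq_norm X b"
      by (rule seq_norm_mono[OF X b])
    have nonneg: "0 \<le> seq_norm X x"
      using coordinate_le_seq_norm[OF X x, of 0] norm_ge_zero order_trans by blast
    have kx: "k n * x n = of_real (cmod (k n * b n))" if "n < N" for n
    proof -
      have "z * cnj (sgn z) = of_real (cmod z)" for z
        by (cases "z = 0") (auto simp: sgn_eq complex_norm_square[symmetric] power2_eq_square)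
      then show ?thesis
        using that by (simp add: x_def mult.assoc[symmetric])
    qed
    have "functional k x = (\<Sum>n<N. k n * x n)"
      unfolding functional_def by (rule suminf_finite) (auto simp: x_def)
    also have "\<dots> = of_real (\<Sum>n<N. cmod (k n * b n))"
      using kx by simp
    finally have "cmod (functional k x) = (\<Sum>n<N. cmod (k n * b n))"
      by (simp only: norm_of_real) (simp add: sum_nonneg)
    then have "(\<Sum>n<N. cmod (k n * b n)) \<le> C * seq_norm X x"
      using C[OF x] by simp
    also have "\<dots> \<le> \<bar>C\<bar> * seq_norm X x"
      using nonneg by (intro mult_right_mono) auto
    also have "\<dots> \<le> \<bar>C\<bar> * seq_norm X b"
      using norm_x by (intro mult_left_mono) auto
    finally show ?thesis .
  qed
  then show ?thesis
    by (intro summableI_nonneg_bounded) auto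
qed

section \<open>The diagonalizing operators as Cauchy matrices\<close>

text \<open>Let \<open>v = b / (z - a)\<close> entrywise. Since the functional maps \<open>v\<close> to \<open>1\<close>, the sequence \<open>v\<close> is an
  eigenvector for \<open>z\<close>, so \<open>z\<close> is some \<open>\<mu> i\<close>; as every eigenvector for \<open>z\<close> is a multiple of \<open>v\<close>, column
  \<open>i\<close> of \<open>P\<close> is \<open>d v\<close>. Coordinate \<open>i\<close> of \<open>Q\<close> turns the operator into multiplication by \<open>z\<close>; on unit
  sequences this shows that row \<open>i\<close> of \<open>Q\<close> is a multiple of \<open>k / (z - a)\<close>. For the product of the two
  scalars, note that \<open>w = b / (z - a)\<^sup>2\<close> satisfies \<open>(T - z) w = - v + (k w) b\<close>. Coordinate \<open>i\<close> of \<open>Q\<close>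
  annihilates the left-hand side, so \<open>h (k w) = (Q v) i = 1 / d\<close>. In particular \<open>k w \<noteq> 0\<close>: the
  eigenvalue is a simple root.\<close>

lemma diagonal_form_entries:
  fixes a b k \<mu> :: "nat \<Rightarrow> complex"
  assumes X: "banach_seq_space X" and P: "bounded_op X P" and Q: "bounded_op X Q"
    and inv: "inverse_ops X P Q" and \<mu>: "bounded_op X (diag_op \<mu>)"
    and T: "\<And>x. x \<in> seqs X \<Longrightarrow> perturbed_op a b k x = P (diag_op \<mu> (Q x))"
    and b: "b \<in> seqs X" "b m0 \<noteq> 0"
    and z: "\<And>n. z \<noteq> a n" "convergent (\<lambda>n. 1 / (z - a n))"
    and root: "functional k (\<lambda>n. b n / (z - a n)) = 1"
  shows "\<exists>i d h. \<mu> i = z \<and> (\<forall>n. P (unit_seq i) n = d * (b n / (z - a n))) \<and>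
           (\<forall>n. Q (unit_seq n) i = h * (k n / (z - a n))) \<and>
           d * h * functional k (\<lambda>n. b n / (z - a n)\<^sup>2) = 1"
proof -
  define v w where "v n = b n / (z - a n)" and "w n = b n / (z - a n)\<^sup>2" for n
  define G where "G = functional k w"
  have za: "z - a n \<noteq> 0" for n
    using z(1)[of n] by simp
  have v: "v \<in> seqs X"
    using convergent_mult_in_seqs[OF X z(2) b(1)] by (simp add: v_def[abs_def])
  have w: "w \<in> seqs X"
    using convergent_mult_in_seqs[OF X z(2) v] by (simp add: v_def w_def[abs_def] power2_eq_square)
  have Qmem: "Q x \<in> seqs X" and Pmem: "P x \<in> seqs X" and \<mu>mem: "diag_op \<mu> x \<in> seqs X"
    and Qadd: "\<And>y. y \<in> seqs X \<Longrightarrow> Q (\<lambda>n. x n + y n) = (\<lambda>n. Q x n + Q y n)"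
    and Qscale: "\<And>c. Q (\<lambda>n. c * x n) = (\<lambda>n. c * Q x n)"
    and Pscale: "\<And>c. P (\<lambda>n. c * x n) = (\<lambda>n. c * P x n)"
    and PQ: "P (Q x) = x" and QP: "Q (P x) = x" if "x \<in> seqs X" for x
    using that P Q \<mu> inv unfolding bounded_op_def inverse_ops_def by blast+
  have intertwine: "Q (perturbed_op a b k x) i = \<mu> i * Q x i" if "x \<in> seqs X" for x i
    using T[OF that] QP[OF \<mu>mem[OF Qmem[OF that]]] by (simp add: diag_op_def)
  have "perturbed_op a b k v = (\<lambda>n. z * v n)"
  proof
    fix n
    have "b n = (z - a n) * v n"
      using za[of n] by (simp add: v_def)
    then show "perturbed_op a b k v n = z * v n"
      using root by (simp add: perturbed_op_def diag_op_def v_def[abs_def, symmetric] algebra_simps)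
  qed
  then have Qv: "z * Q v i = \<mu> i * Q v i" for i
    using intertwine[OF v, of i] Qscale[OF v, of z] by simp
  have "\<exists>i. Q v i \<noteq> 0"
  proof (rule ccontr)
    assume "\<not> ?thesis"
    then have "Q v = (\<lambda>n. 0 * Q v n)"
      by auto
    then have "v = (\<lambda>n. 0 * P (Q v) n)"
      using PQ[OF v] Pscale[OF Qmem[OF v], of 0] by simp
    then have "v m0 = 0"
      by (metis mult_zero_left)
    then show False
      using b(2) za[of m0] by (simp add: v_def)
  qed
  then obtain i where i: "Q v i \<noteq> 0" "\<mu> i = z"
    using Qv by (metis mult_right_cancel)
  define x where "x = P (unit_seq i)"
  \<comment> \<open>Coordinate \<open>n\<close> of the eigenvalue equation reads \<open>(z - a n) * x n = b n * d\<close>.\<close>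
  define d where "d = functional k x"
  have x: "x \<in> seqs X"
    unfolding x_def by (rule Pmem[OF unit_seq_in_seqs])
  have "diag_op \<mu> (unit_seq i) = (\<lambda>n. z * unit_seq i n)"
    using i by (auto simp: diag_op_def unit_seq_def)
  then have "perturbed_op a b k x = (\<lambda>n. z * x n)"
    using T[OF x] QP[OF unit_seq_in_seqs, of i] Pscale[OF unit_seq_in_seqs, of z i]
    by (simp add: x_def)
  then have "a n * x n + b n * d = z * x n" for n
    by (metis d_def diag_op_def perturbed_op_def)
  then have "(z - a n) * x n = d * b n" for n
    by (simp add: algebra_simps)
  then have xv: "x n = d * v n" for n
    using za[of n] by (simp add: v_def eq_divide_eq mult.commute)
  then have "unit_seq i = (\<lambda>n. d * Q v n)"
    using QP[OF unit_seq_in_seqs, of i] Qscale[OF v, of d] by (simp add: x_def[symmetric] fun_eq_iff)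
      (metis ext)
  then have dQv: "d * Q v i = 1"
    by (metis unit_seq_def)
  define h where "h = Q b i"
  have Tw: "perturbed_op a b k w = (\<lambda>n. (z * w n + (- 1) * v n) + G * b n)"
  proof
    fix n
    have "v n = (z - a n) * w n"
      using za[of n] by (simp add: v_def w_def power2_eq_square)
    then show "perturbed_op a b k w n = (z * w n + (- 1) * v n) + G * b n"
      by (simp add: perturbed_op_def diag_op_def G_def algebra_simps)
  qed
  have zw_v: "(\<lambda>n. z * w n + (- 1) * v n) = (\<lambda>n. a n * w n)"
  proof
    fix n
    have "v n = (z - a n) * w n"
      using za[of n] by (simp add: v_def w_def power2_eq_square)
    then show "z * w n + (- 1) * v n = a n * w n"
      by (simp add: algebra_simps)
  qed
  have aw: "(\<lambda>n. z * w n + (- 1) * v n) \<in> seqs X"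
  proof -
    have "(\<lambda>n. (z * (1 / (z - a n)) - 1) * v n) \<in> seqs X"
      by (intro convergent_mult_in_seqs X v convergent_diff convergent_mult z(2) convergent_const)
    moreover have "(z * (1 / (z - a n)) - 1) * v n = z * w n + (- 1) * v n" for n
      by (simp add: v_def w_def power2_eq_square algebra_simps)
    ultimately show ?thesis
      by simp
  qed
  have "Q (perturbed_op a b k w) = (\<lambda>n. (z * Q w n + (- 1) * Q v n) + G * Q b n)"
    unfolding Tw using Qadd[OF aw seqs_scale[OF X b(1)]] Qadd[OF seqs_scale[OF X w] seqs_scale[OF X v]]
      Qscale[OF w] Qscale[OF v] Qscale[OF b(1)] by metis
  then have "\<mu> i * Q w i = (z * Q w i + (- 1) * Q v i) + G * h"
    using intertwine[OF w, of i] by (simp add: h_def)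
  then have "G * h = Q v i"
    using i by simp
  then have dhG: "d * h * G = 1"
    using dQv by (metis mult.assoc mult.commute)
  have row: "Q (unit_seq n) i = h * (k n / (z - a n))" for n
  proof -
    have "functional k (unit_seq n) = (\<Sum>m\<in>{n}. k m * unit_seq n m)"
      unfolding functional_def by (rule suminf_finite) (auto simp: unit_seq_def)
    then have "perturbed_op a b k (unit_seq n) = (\<lambda>m. a n * unit_seq n m + k n * b m)"
      by (auto simp: perturbed_op_def diag_op_def unit_seq_def)
    moreover have "Q (\<lambda>m. a n * unit_seq n m + k n * b m)
        = (\<lambda>m. a n * Q (unit_seq n) m + k n * Q b m)"
      using Qadd[OF seqs_scale[OF X unit_seq_in_seqs] seqs_scale[OF X b(1)]]
        Qscale[OF unit_seq_in_seqs] Qscale[OF b(1)] by metis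
    ultimately have "z * Q (unit_seq n) i = a n * Q (unit_seq n) i + k n * h"
      using intertwine[OF unit_seq_in_seqs, of n i] i by (simp add: h_def)
    then have "(z - a n) * Q (unit_seq n) i = h * k n"
      by (simp add: algebra_simps)
    then show ?thesis
      using za[of n] by (simp add: eq_divide_eq mult.commute)
  qed
  show ?thesis
    using i xv dhG row unfolding x_def G_def v_def[abs_def] w_def[abs_def] by blast
qed

text \<open>The norms of \<open>P\<close> and \<open>Q\<close> bound all entries found in \<open>diagonal_form_entries\<close>; the scalar of the row
  of \<open>Q\<close> has absolute value \<open>1 / (\<delta> j \<bar>G j\<bar>)\<close>. Column sums of powers are bounded in \<open>\<ell>\<^sup>p\<close>, row sums
  under the sup norm. In a row sum each column of \<open>P\<close> must occur only once, which is why the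
  eigenvalues have to be distinct there.\<close>

lemma eigenvector_matrix_bounds:
  fixes a l :: "nat \<Rightarrow> real" and b k :: "nat \<Rightarrow> complex"
  defines "G \<equiv> \<lambda>j. functional k (\<lambda>n. b n / (of_real (l j) - of_real (a n))\<^sup>2)"
  assumes X: "banach_seq_space X" and a: "\<And>n. 0 < a n" and null: "a \<longlonglongrightarrow> 0"
    and b: "b \<in> seqs X" "\<And>n. b n \<noteq> 0" and l: "\<And>n. l n < 0"
    and diag: "diagonalizable X (perturbed_op (\<lambda>n. of_real (a n)) b k)"
    and root: "\<And>j. functional k (\<lambda>n. b n / (of_real (l j) - of_real (a n))) = 1"
  obtains \<delta> C p D where "0 < C" and "\<forall>j. 0 < \<delta> j" and "\<forall>j. 0 < cmod (G j)" and "0 < p"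
    and "\<forall>j n. \<delta> j * cmod (b n) \<le> C * (a n - l j)"
    and "\<forall>j n. cmod (k n) \<le> C * (\<delta> j * cmod (G j) * (a n - l j))"
    and "inj l \<longrightarrow>
      (\<forall>j F. finite F \<longrightarrow> (\<Sum>n\<in>F. (\<delta> j * cmod (b n) / (a n - l j)) powr p) \<le> D) \<or>
      (\<forall>n F. finite F \<longrightarrow> (\<Sum>j\<in>F. (\<delta> j * cmod (b n) / (a n - l j)) powr p) \<le> D)"
proof -
  obtain P Q \<mu> where P: "bounded_op X P" and Q: "bounded_op X Q" and PQ: "inverse_ops X P Q"
    and \<mu>: "bounded_op X (diag_op \<mu>)"
    and T: "\<And>x. x \<in> seqs X \<Longrightarrow> perturbed_op (\<lambda>n. of_real (a n)) b k x = P (diag_op \<mu> (Q x))"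
    using diag unfolding diagonalizable_def by blast
  have gap: "a n - l j > 0" for n j
    using a[of n] l[of j] by simp
  have norm_gap: "cmod (of_real (l j) - of_real (a n)) = a n - l j" for n j
    using gap[of n j] unfolding of_real_diff[symmetric] norm_of_real by simp
  have "\<exists>i d h. \<mu> i = of_real (l j) \<and>
      (\<forall>n. P (unit_seq i) n = d * (b n / (of_real (l j) - of_real (a n)))) \<and>
      (\<forall>n. Q (unit_seq n) i = h * (k n / (of_real (l j) - of_real (a n)))) \<and> d * h * G j = 1" for j
    unfolding G_def
  proof (rule diagonal_form_entries[OF X P Q PQ \<mu> T b(1) b(2)[of 0] _ _ root])
    show "complex_of_real (l j) \<noteq> of_real (a n)" for n
      using gap[of n j] by auto
    have "(\<lambda>n. 1 / (complex_of_real (l j) - of_real (a n))) \<longlonglongrightarrow> 1 / (of_real (l j) - of_real 0)"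
      using l[of j] by (intro tendsto_intros null) auto
    then show "convergent (\<lambda>n. 1 / (complex_of_real (l j) - of_real (a n)))"
      by (rule convergentI)
  qed
  then obtain \<nu> d h where \<nu>: "\<And>j. \<mu> (\<nu> j) = of_real (l j)"
    and Pe: "\<And>j n. P (unit_seq (\<nu> j)) n = d j * (b n / (of_real (l j) - of_real (a n)))"
    and Qe: "\<And>j n. Q (unit_seq n) (\<nu> j) = h j * (k n / (of_real (l j) - of_real (a n)))"
    and dhG: "\<And>j. d j * h j * G j = 1"
    by metis
  obtain C1 where C1: "C1 > 0" "\<And>x. x \<in> seqs X \<Longrightarrow> seq_norm X (P x) \<le> C1 * seq_norm X x"
    using bounded_op_bound[OF X P] by blast
  obtain C2 where C2: "C2 > 0" "\<And>x. x \<in> seqs X \<Longrightarrow> seq_norm X (Q x) \<le> C2 * seq_norm X x"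
    using bounded_op_bound[OF X Q] by blast
  define C where "C = max C1 C2"
  have norm_unit: "seq_norm X (R (unit_seq n)) \<le> C'"
    if "C' > 0" "\<And>x. x \<in> seqs X \<Longrightarrow> seq_norm X (R x) \<le> C' * seq_norm X x" for R C' n
    using that(2)[OF unit_seq_in_seqs, of n] mult_left_mono[OF seq_norm_unit_seq[of X n], of C'] that(1)
    by linarith
  have Pmem: "P (unit_seq n) \<in> seqs X" and Qmem: "Q (unit_seq n) \<in> seqs X" for n
    using P Q unit_seq_in_seqs unfolding bounded_op_def by blast+
  have norm_Pe: "cmod (P (unit_seq (\<nu> j)) n) = cmod (d j) * cmod (b n) / (a n - l j)" for j n
    by (simp add: Pe norm_mult norm_divide norm_gap)
  have "G j \<noteq> 0" "d j \<noteq> 0" for j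
    using dhG[of j] by auto
  show thesis
  proof
    show "0 < C"
      using C1 by (simp add: C_def)
    show "\<forall>j. 0 < cmod (d j)" "\<forall>j. 0 < cmod (G j)"
      using \<open>\<And>j. d j \<noteq> 0\<close> \<open>\<And>j. G j \<noteq> 0\<close> by auto
    show "\<forall>j n. cmod (d j) * cmod (b n) \<le> C * (a n - l j)"
    proof (intro allI)
      fix j n
      have "cmod (P (unit_seq (\<nu> j)) n) \<le> C1"
        using coordinate_le_seq_norm[OF X Pmem] norm_unit[OF C1] by (rule order_trans)
      then have "cmod (d j) * cmod (b n) / (a n - l j) \<le> C"
        unfolding norm_Pe by (simp add: C_def)
      then show "cmod (d j) * cmod (b n) \<le> C * (a n - l j)"
        using gap[of n j] by (simp add: divide_le_eq)
    qed
    show "\<forall>j n. cmod (k n) \<le> C * (cmod (d j) * cmod (G j) * (a n - l j))"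
    proof (intro allI)
      fix j n
      have "cmod (Q (unit_seq n) (\<nu> j)) \<le> C2"
        using coordinate_le_seq_norm[OF X Qmem] norm_unit[OF C2] by (rule order_trans)
      then have "cmod (h j) * cmod (k n) / (a n - l j) \<le> C"
        by (simp add: Qe norm_mult norm_divide norm_gap C_def)
      then have "cmod (h j) * cmod (k n) \<le> C * (a n - l j)"
        using gap[of n j] by (simp add: divide_le_eq)
      then have "cmod (d j) * cmod (G j) * (cmod (h j) * cmod (k n))
          \<le> cmod (d j) * cmod (G j) * (C * (a n - l j))"
        by (intro mult_left_mono) auto
      moreover have "cmod (d j) * cmod (G j) * cmod (h j) = 1"
        using arg_cong[OF dhG[of j], of cmod] by (simp add: norm_mult mult_ac)
      ultimately show "cmod (k n) \<le> C * (cmod (d j) * cmod (G j) * (a n - l j))"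
        by (simp add: mult_ac) (metis (no_types, lifting) mult.assoc mult.left_commute mult_1)
    qed
    \<comment> \<open>For the sup-norm spaces the powers are trivial.\<close>
    define p where "p = (case X of Ell p \<Rightarrow> p | _ \<Rightarrow> 1)"
    show "0 < p"
      using X by (cases X) (auto simp: p_def)
    show "inj l \<longrightarrow> (\<forall>j F. finite F \<longrightarrow> (\<Sum>n\<in>F. (cmod (d j) * cmod (b n) / (a n - l j)) powr p) \<le> C powr p) \<or>
      (\<forall>n F. finite F \<longrightarrow> (\<Sum>j\<in>F. (cmod (d j) * cmod (b n) / (a n - l j)) powr p) \<le> C powr p)"
    proof (cases "\<exists>q. X = Ell q")
      case True
      then have Xp: "X = Ell p" "1 \<le> p"
        using X by (auto simp: p_def)
      have "(\<Sum>n\<in>F. cmod (P (unit_seq (\<nu> j)) n) powr p) \<le> C powr p" if "finite F" for j F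
      proof -
        have "(\<Sum>n\<in>F. cmod (P (unit_seq (\<nu> j)) n) powr p) \<le> seq_norm X (P (unit_seq (\<nu> j))) powr p"
          unfolding Xp(1) by (intro sum_powr_le_seq_norm Pmem[unfolded Xp(1)] Xp that)
        also have "\<dots> \<le> C powr p"
        proof (rule powr_mono2)
          show "seq_norm X (P (unit_seq (\<nu> j))) \<le> C"
            using norm_unit[OF C1, of "\<nu> j"] by (simp add: C_def)
          show "0 \<le> seq_norm X (P (unit_seq (\<nu> j)))"
            using coordinate_le_seq_norm[OF X Pmem] norm_ge_zero by (rule order_trans[rotated])
        qed (use Xp in simp)
        finally show ?thesis .
      qed
      then show ?thesis
        unfolding norm_Pe by blast
    next
      case False
      then have XE: "X \<noteq> Ell q" for q
        by blast
      then have p1: "p = 1"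
        by (cases X) (auto simp: p_def)
      have "inj \<nu>" if "inj l"
        by (rule injI) (metis \<nu> of_real_eq_iff that injD)
      have "(\<Sum>j\<in>F. (cmod (d j) * cmod (b n) / (a n - l j)) powr p) \<le> C powr p" if "inj l" "finite F" for n F
      proof -
        have "(\<Sum>j\<in>F. cmod (P (unit_seq (\<nu> j)) n)) = (\<Sum>i\<in>\<nu> ` F. cmod (P (unit_seq i) n))"
          using \<open>inj l \<Longrightarrow> inj \<nu>\<close>[OF that(1)] by (subst sum.reindex) (auto intro: inj_on_subset)
        also have "\<dots> \<le> C1"
          using that(2) C1 by (intro row_sums_bounded[OF X XE P]) auto
        finally have "(\<Sum>j\<in>F. cmod (d j) * cmod (b n) / (a n - l j)) \<le> C"
          unfolding norm_Pe by (simp add: C_def)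
        moreover have "(cmod (d j) * cmod (b n) / (a n - l j)) powr p = cmod (d j) * cmod (b n) / (a n - l j)" for j
          using gap[of n j] by (simp add: p1 less_imp_le)
        moreover have "C powr p = C"
          using C1 by (simp add: p1 C_def)
        ultimately show ?thesis
          by simp
      qed
      then show ?thesis
        by blast
    qed
  qed
qed

text \<open>The entry bounds for \<open>P\<close> and \<open>Q\<close> at the \<open>i\<close>-th largest \<open>a\<close> and the \<open>i\<close>-th largest \<open>\<bar>\<lambda>\<bar>\<close> meet
  \<open>residue_ratio_bounds\<close>: their product bounds the cross ratios above by \<open>K\<close>, and the lower bound \<open>1\<close>
  for the product of entries keeps the diagonal of \<open>P\<close> away from \<open>0\<close>. A repeated \<open>\<lambda>\<close> would be a double
  root, at which the derivative \<open>G\<close> vanishes; so \<open>\<beta>\<close> decreases strictly.\<close>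

lemma sorted_eigenvector_bounds:
  fixes X :: seq_space and a l \<alpha> \<beta> B :: "nat \<Rightarrow> real" and b :: "nat \<Rightarrow> complex"
  assumes X: "banach_seq_space X"
    and a: "\<And>n. 0 < a n" "inj a" "summable a" and l: "\<And>n. l n < 0" "summable l"
    and b: "b \<in> seqs X" "\<And>n. b n \<noteq> 0"
    and dual: "in_dual X (gain (\<lambda>n. of_real (a n)) b (\<lambda>n. of_real (l n)))"
    and diagonalizable: "diagonalizable X (perturbed_op (\<lambda>n. of_real (a n)) b
      (gain (\<lambda>n. of_real (a n)) b (\<lambda>n. of_real (l n))))"
    and bij: "bij \<sigma>" "bij \<tau>"
    and \<alpha>_eq: "\<And>n. \<alpha> n = a (\<sigma> n)" and \<beta>_eq: "\<And>n. \<beta> n = - l (\<tau> n)"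
    and B_eq: "\<And>n. B n = cmod (b (\<sigma> n))"
    and dec: "decseq \<alpha>" "decseq \<beta>"
  obtains \<delta> C K p D where "0 < C" and "1 < K" and "0 < p" and "\<forall>n. 0 < \<delta> n"
    and "\<forall>n m. n < m \<longrightarrow> \<alpha> m < \<alpha> n" and "\<forall>n m. n < m \<longrightarrow> \<beta> m < \<beta> n"
    and "\<forall>n. \<alpha> n + \<beta> n \<le> C * (\<delta> n * B n)"
    and "\<forall>n m. n < m \<longrightarrow>
      (\<alpha> n + \<beta> m) * (\<beta> n + \<alpha> m) \<le> K * ((\<alpha> n - \<alpha> m) * (\<beta> n - \<beta> m))"
    and "(\<forall>j F. finite F \<longrightarrow> (\<Sum>n\<in>F. (\<delta> j * B n / (\<beta> j + \<alpha> n)) powr p) \<le> D) \<or>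
      (\<forall>n F. finite F \<longrightarrow> (\<Sum>j\<in>F. (\<delta> j * B n / (\<beta> j + \<alpha> n)) powr p) \<le> D)"
proof -
  define k where "k = gain (\<lambda>n. complex_of_real (a n)) b (\<lambda>n. complex_of_real (l n))"
  define W where "W n = - (k (\<sigma> n) * b (\<sigma> n))" for n
  have null: "a \<longlonglongrightarrow> 0"
    by (rule summable_LIMSEQ_zero[OF a(3)])
  have \<alpha>: "0 < \<alpha> n" and \<beta>: "0 < \<beta> n" and B: "0 < B n" for n
    using a(1) l(1) b(2) by (auto simp: \<alpha>_eq \<beta>_eq B_eq)
  have inj_\<alpha>: "inj \<alpha>"
    using a(2) bij_is_inj[OF bij(1)] by (auto simp: \<alpha>_eq inj_def)
  have dec\<alpha>: "\<alpha> n < \<alpha> m" if "m < n" for m n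
    using decseqD[OF dec(1), of m n] that inj_\<alpha> by (auto simp: less_le inj_def)
  have limW: "(\<lambda>N. of_real (residue_weight \<alpha> \<beta> N i)) \<longlonglongrightarrow> W i" for i
    unfolding ext[of \<alpha>, OF \<alpha>_eq] ext[of \<beta>, OF \<beta>_eq] W_def k_def
    by (rule residue_weight_tendsto_gain[OF a(1,2) l(1) a(3) l(2) bij b(2)])
  have sum_kb: "summable (\<lambda>n. cmod (k n * b n))"
    using dual_product_summable[OF X _ b(1)] dual by (simp add: k_def)
  have sum_W: "summable (\<lambda>n. norm (W n))"
    using summable_reindex[OF sum_kb bij_is_inj[OF bij(1)]] by (simp add: W_def o_def)
  have functional_eq: "functional k (\<lambda>n. b n / (of_real (l (\<tau> j)) - of_real (a n)) ^ q)
      = (- 1) ^ Suc q * (\<Sum>n. W n / of_real ((\<beta> j + \<alpha> n) ^ q))" for j q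
  proof -
    define f where "f n = k n * (b n / (of_real (l (\<tau> j)) - of_real (a n)) ^ q)" for n
    have "summable (\<lambda>n. norm (f n))"
    proof (rule summable_comparison_test')
      show "summable (\<lambda>n. cmod (k n * b n) / \<beta> j ^ q)"
        using sum_kb by (rule summable_divide)
      fix n
      have "cmod (of_real (l (\<tau> j)) - of_real (a n)) = \<beta> j + a n"
        using l(1)[of "\<tau> j"] a(1)[of n] unfolding of_real_diff[symmetric] norm_of_real by (simp add: \<beta>_eq)
      then have "norm (f n) = cmod (k n * b n) / (\<beta> j + a n) ^ q"
        by (simp add: f_def norm_mult norm_divide norm_power)
      also have "\<dots> \<le> cmod (k n * b n) / \<beta> j ^ q"
        using \<beta>[of j] a(1)[of n] by (intro divide_left_mono power_mono mult_pos_pos) auto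
      finally show "norm (norm (f n)) \<le> cmod (k n * b n) / \<beta> j ^ q"
        by simp
    qed
    then have "functional k (\<lambda>n. b n / (of_real (l (\<tau> j)) - of_real (a n)) ^ q) = (\<Sum>n. f (\<sigma> n))"
      using suminf_permuted[OF _ bij(1), of f] by (simp add: functional_def f_def)
    also have "(\<lambda>n. f (\<sigma> n)) = (\<lambda>n. (- 1) ^ Suc q * (W n / of_real ((\<beta> j + \<alpha> n) ^ q)))"
    proof
      fix n
      have "complex_of_real (l (\<tau> j)) - of_real (a (\<sigma> n)) = (- 1) * of_real (\<beta> j + \<alpha> n)"
        by (simp add: \<alpha>_eq \<beta>_eq)
      then have "(complex_of_real (l (\<tau> j)) - of_real (a (\<sigma> n))) ^ q
          = (- 1) ^ q * of_real ((\<beta> j + \<alpha> n) ^ q)"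
        by (simp only: power_mult_distrib of_real_power)
      then show "f (\<sigma> n) = (- 1) ^ Suc q * (W n / of_real ((\<beta> j + \<alpha> n) ^ q))"
        by (cases "even q") (simp_all add: f_def W_def)
    qed
    also have "(\<Sum>n. (- 1) ^ Suc q * (W n / of_real ((\<beta> j + \<alpha> n) ^ q)))
        = (- 1) ^ Suc q * (\<Sum>n. W n / of_real ((\<beta> j + \<alpha> n) ^ q))"
    proof (rule suminf_mult)
      have "(\<beta> j) ^ q \<le> (\<beta> j + \<alpha> n) ^ q" for n
        using \<beta>[of j] \<alpha>[of n] by (intro power_mono) auto
      then have "norm (W n / of_real ((\<beta> j + \<alpha> n) ^ q)) \<le> norm (W n) / \<beta> j ^ q" for n
        using \<beta>[of j] \<alpha>[of n] unfolding norm_divide norm_of_real by (intro frac_le) auto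
      then show "summable (\<lambda>n. W n / of_real ((\<beta> j + \<alpha> n) ^ q))"
        by (rule summable_comparison_test'[OF summable_divide[OF sum_W], of 0])
    qed
    finally show ?thesis .
  qed
  \<comment> \<open>The case \<open>q = 1\<close> above is the eigenvalue equation, the case \<open>q = 2\<close> the derivative at the root.\<close>
  define G where "G j = cmod (\<Sum>n. W n / of_real ((\<beta> j + \<alpha> n)\<^sup>2))" for j
  have root: "functional k (\<lambda>n. b n / (of_real (l (\<tau> j)) - of_real (a n))) = 1" for j
    using functional_eq[of j 1] residue_sums(1)[of \<alpha> \<beta> W j, OF \<alpha> dec\<alpha> \<beta> limW sum_W] by simp
  have G_eq: "cmod (functional k (\<lambda>n. b n / (of_real (l (\<tau> j)) - of_real (a n))\<^sup>2)) = G j" for j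
    unfolding functional_eq G_def by simp
  have limG: "(\<lambda>N. (\<Prod>m\<in>{..<N}-{j}. \<bar>\<beta> j - \<beta> m\<bar>) / (\<Prod>m<N. \<beta> j + \<alpha> m)) \<longlonglongrightarrow> G j" for j
    unfolding G_def by (rule residue_sums(2)[of \<alpha> \<beta> W j, OF \<alpha> dec\<alpha> \<beta> limW sum_W])
  note bounds = eigenvector_matrix_bounds[of X a b "\<lambda>j. l (\<tau> j)" k,
      OF X a(1) null b l(1) diagonalizable[folded k_def] root, unfolded G_eq]
  obtain \<delta> C p D where C: "0 < C" and \<delta>': "\<forall>j. 0 < \<delta> j" and G': "\<forall>j. 0 < G j" and p: "0 < p"
    and P': "\<forall>j n. \<delta> j * cmod (b n) \<le> C * (a n - l (\<tau> j))"
    and Q': "\<forall>j n. cmod (k n) \<le> C * (\<delta> j * G j * (a n - l (\<tau> j)))"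
    and sums: "inj (\<lambda>j. l (\<tau> j)) \<longrightarrow>
      (\<forall>j F. finite F \<longrightarrow> (\<Sum>n\<in>F. (\<delta> j * cmod (b n) / (a n - l (\<tau> j))) powr p) \<le> D) \<or>
      (\<forall>n F. finite F \<longrightarrow> (\<Sum>j\<in>F. (\<delta> j * cmod (b n) / (a n - l (\<tau> j))) powr p) \<le> D)"
    by (rule bounds) (rule that)
  have \<delta>: "0 < \<delta> j" and G: "0 < G j" and P_le: "\<delta> j * cmod (b n) \<le> C * (a n - l (\<tau> j))"
    and Q_le: "cmod (k n) \<le> C * (\<delta> j * G j * (a n - l (\<tau> j)))" for j n
    using \<delta>' G' P' Q' by auto
  have inj_\<beta>: "inj \<beta>"
  proof (rule injI, rule ccontr)
    fix i m assume eq: "\<beta> i = \<beta> m" and "i \<noteq> m"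
    have "(\<Prod>m\<in>{..<N}-{i}. \<bar>\<beta> i - \<beta> m\<bar>) / (\<Prod>m<N. \<beta> i + \<alpha> m) = 0" if "N \<ge> Suc m" for N
    proof -
      have "(\<Prod>m\<in>{..<N}-{i}. \<bar>\<beta> i - \<beta> m\<bar>) = 0"
        using that eq \<open>i \<noteq> m\<close> by (intro prod_zero bexI[of _ m]) auto
      then show ?thesis
        by simp
    qed
    then have "(\<lambda>N. (\<Prod>m\<in>{..<N}-{i}. \<bar>\<beta> i - \<beta> m\<bar>) / (\<Prod>m<N. \<beta> i + \<alpha> m)) \<longlonglongrightarrow> 0"
      by (intro tendsto_eventually eventually_sequentiallyI)
    then show False
      using LIMSEQ_unique[OF limG[of i]] G[of i] by auto
  qed
  have dec\<beta>: "\<beta> n < \<beta> m" if "m < n" for m n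
    using decseqD[OF dec(2), of m n] that inj_\<beta> by (auto simp: less_le inj_def)
  have s: "0 < \<alpha> n + \<beta> n" for n
    using \<alpha>[of n] \<beta>[of n] by simp
  have W_le: "cmod (W i) \<le> C * G i * (\<alpha> i + \<beta> i) * (\<delta> i * B i)" for i
    using mult_right_mono[OF Q_le[of "\<sigma> i" i], of "B i"] B[of i]
    by (simp add: W_def norm_mult B_eq \<alpha>_eq \<beta>_eq mult_ac)
  have diag: "\<alpha> i + \<beta> i \<le> C * (\<delta> i * B i)" for i
  proof -
    have "G i * (\<alpha> i + \<beta> i) * (\<alpha> i + \<beta> i) \<le> G i * (\<alpha> i + \<beta> i) * (C * (\<delta> i * B i))"
      using residue_ratio_bounds(1)[of \<alpha> \<beta> i W, OF \<alpha> dec\<alpha> \<beta> dec\<beta> limW limG] W_le[of i]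
      by (simp add: power2_eq_square mult_ac)
    then show ?thesis
      using G[of i] s[of i] by simp
  qed
  \<comment> \<open>\<open>C * C\<close> bounds the product of an entry of \<open>P\<close> and one of \<open>Q\<close>; the summand \<open>1\<close> ensures \<open>K > 1\<close>.\<close>
  define K where "K = C * C + 1"
  have K: "K > 1"
    using C by (simp add: K_def)
  have W_K: "cmod (W i) \<le> K * (G i * (\<alpha> i + \<beta> i)\<^sup>2)" for i
  proof -
    have "\<delta> i * B i \<le> C * (\<alpha> i + \<beta> i)"
      using P_le[of i "\<sigma> i"] by (simp add: B_eq \<alpha>_eq \<beta>_eq)
    then have "C * G i * (\<alpha> i + \<beta> i) * (\<delta> i * B i) \<le> C * G i * (\<alpha> i + \<beta> i) * (C * (\<alpha> i + \<beta> i))"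
      using C G[of i] s[of i] by (intro mult_left_mono) auto
    also have "\<dots> = C * C * (G i * (\<alpha> i + \<beta> i)\<^sup>2)"
      by (simp add: power2_eq_square mult_ac)
    also have "\<dots> \<le> K * (G i * (\<alpha> i + \<beta> i)\<^sup>2)"
      using G[of i] by (intro mult_right_mono) (auto simp: K_def)
    finally show ?thesis
      using W_le[of i] by linarith
  qed
  have factor: "(\<alpha> n + \<beta> m) * (\<beta> n + \<alpha> m) \<le> K * ((\<alpha> n - \<alpha> m) * (\<beta> n - \<beta> m))" if "n < m" for n m
  proof -
    have pos: "0 < G n * (\<alpha> n + \<beta> n)\<^sup>2"
      using G[of n] s[of n] by simp
    have "(\<alpha> n + \<beta> m) * (\<beta> n + \<alpha> m) * (G n * (\<alpha> n + \<beta> n)\<^sup>2)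
        \<le> (\<alpha> n - \<alpha> m) * (\<beta> n - \<beta> m) * cmod (W n)"
      using residue_ratio_bounds(2)[of \<alpha> \<beta> n W, OF \<alpha> dec\<alpha> \<beta> dec\<beta> limW limG, of m] that by simp
    also have "\<dots> \<le> (\<alpha> n - \<alpha> m) * (\<beta> n - \<beta> m) * (K * (G n * (\<alpha> n + \<beta> n)\<^sup>2))"
      using dec\<alpha>[OF that] dec\<beta>[OF that] by (intro mult_left_mono W_K) auto
    finally have "(\<alpha> n + \<beta> m) * (\<beta> n + \<alpha> m) * (G n * (\<alpha> n + \<beta> n)\<^sup>2)
        \<le> K * ((\<alpha> n - \<alpha> m) * (\<beta> n - \<beta> m)) * (G n * (\<alpha> n + \<beta> n)\<^sup>2)"
      by (simp add: mult_ac)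
    then show ?thesis
      using pos by (rule mult_right_le_imp_le)
  qed
  have matrix_sums: "(\<forall>j F. finite F \<longrightarrow> (\<Sum>n\<in>F. (\<delta> j * B n / (\<beta> j + \<alpha> n)) powr p) \<le> D) \<or>
    (\<forall>n F. finite F \<longrightarrow> (\<Sum>j\<in>F. (\<delta> j * B n / (\<beta> j + \<alpha> n)) powr p) \<le> D)"
  proof -
    have entry: "\<delta> j * B n / (\<beta> j + \<alpha> n) = \<delta> j * cmod (b (\<sigma> n)) / (a (\<sigma> n) - l (\<tau> j))" for j n
      by (simp add: B_eq \<alpha>_eq \<beta>_eq)
    have reindex: "(\<Sum>n\<in>F. (\<delta> j * B n / (\<beta> j + \<alpha> n)) powr p)
        = (\<Sum>n\<in>\<sigma> ` F. (\<delta> j * cmod (b n) / (a n - l (\<tau> j))) powr p)" for j F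
      unfolding entry using bij_is_inj[OF bij(1)] by (subst sum.reindex) (auto intro: inj_on_subset)
    have "inj (\<lambda>j. l (\<tau> j))"
      using inj_\<beta> by (simp add: inj_def \<beta>_eq)
    from sums[rule_format, OF this] show ?thesis
      unfolding reindex unfolding entry by (elim disj_forward) auto
  qed
  show thesis
    by (rule that[of C K p \<delta> D]) (use C K p \<delta> dec\<alpha> dec\<beta> diag factor matrix_sums in simp_all)
qed

section \<open>Decay from a bounded Cauchy matrix\<close>

text \<open>Here \<open>e n m\<close> is an entry of a matrix that dominates \<open>x m / x n\<close> on one side of the diagonal. A
  bound on sums of powers along a line of the matrix bounds the tail sums of \<open>x powr p\<close> by a multiple
  of their first term.\<close>

lemma decay_of_tail_entries:
  fixes x :: "nat \<Rightarrow> real"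
  assumes x: "\<And>n. 0 < x n" and "p > 0" and "c > 0" and e: "\<And>n m. 0 \<le> e n m"
    and le: "\<And>n m. n \<le> m \<Longrightarrow> x m \<le> c * e n m * x n"
    and sums: "\<And>n F. finite F \<Longrightarrow> (\<Sum>m\<in>F. e n m powr p) \<le> D"
  shows "unif_exp_decay x"
proof (rule unif_exp_decay_of_powr[OF x \<open>p > 0\<close>], rule unif_exp_decay_of_tail_sums)
  show "0 < x n powr p" for n
    using x[of n] by simp
  fix n N :: nat
  have "(\<Sum>m=n..N. x m powr p) \<le> (\<Sum>m=n..N. c powr p * x n powr p * e n m powr p)"
  proof (rule sum_mono)
    fix m assume "m \<in> {n..N}"
    then have "x m powr p \<le> (c * e n m * x n) powr p"
      using le[of n m] x[of m] \<open>p > 0\<close> by (intro powr_mono2) auto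
    also have "\<dots> = c powr p * x n powr p * e n m powr p"
      using x[of n] \<open>c > 0\<close> e by (simp add: powr_mult mult_ac)
    finally show "x m powr p \<le> c powr p * x n powr p * e n m powr p" .
  qed
  also have "\<dots> = c powr p * x n powr p * (\<Sum>m=n..N. e n m powr p)"
    by (simp add: sum_distrib_left)
  also have "\<dots> \<le> c powr p * x n powr p * D"
    using x[of n] \<open>c > 0\<close> by (intro mult_left_mono sums) auto
  finally show "(\<Sum>m=n..N. x m powr p) \<le> (c powr p * D) * x n powr p"
    by (simp add: mult_ac)
qed

text \<open>The same domination, summed over the smaller index: now sums of reciprocals up to \<open>m\<close> are bounded
  by a multiple of their last term.\<close>

lemma decay_of_initial_entries:
  fixes x :: "nat \<Rightarrow> real"
  assumes x: "\<And>n. 0 < x n" and "p > 0" and "c > 0" and e: "\<And>m n. 0 \<le> e m n"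
    and le: "\<And>n m. n \<le> m \<Longrightarrow> x m \<le> c * e m n * x n"
    and sums: "\<And>m F. finite F \<Longrightarrow> (\<Sum>n\<in>F. e m n powr p) \<le> D"
  shows "unif_exp_decay x"
proof (rule unif_exp_decay_of_powr[OF x \<open>p > 0\<close>], rule unif_exp_decay_of_inverse_sums)
  show "0 < x n powr p" for n
    using x[of n] by simp
  fix m :: nat
  have "(\<Sum>n\<le>m. 1 / x n powr p) \<le> (\<Sum>n\<le>m. c powr p / x m powr p * e m n powr p)"
  proof (rule sum_mono)
    fix n assume "n \<in> {..m}"
    then have "1 / x n \<le> c * e m n / x m"
      using le[of n m] x[of m] x[of n] by (simp add: field_simps)
    then have "(1 / x n) powr p \<le> (c * e m n / x m) powr p"
      using x[of n] \<open>p > 0\<close> by (intro powr_mono2) (auto simp: less_imp_le)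
    then show "1 / x n powr p \<le> c powr p / x m powr p * e m n powr p"
      using x[of n] x[of m] \<open>c > 0\<close> e by (simp add: powr_mult powr_divide)
  qed
  also have "\<dots> = c powr p / x m powr p * (\<Sum>n\<le>m. e m n powr p)"
    by (simp add: sum_distrib_left)
  also have "\<dots> \<le> c powr p / x m powr p * D"
    using x[of m] \<open>c > 0\<close> by (intro mult_left_mono sums) auto
  finally show "(\<Sum>n\<le>m. 1 / x n powr p) \<le> (c powr p * D) / x m powr p"
    by simp
qed

text \<open>Write \<open>E n j\<close> for the entries and \<open>g n = (\<alpha> n + \<beta> n) / B n\<close>. The hypothesis on the diagonal says
  \<open>\<delta> j \<ge> g j / c\<close>. Replacing \<open>\<beta> j + \<alpha> n\<close> by \<open>\<beta> j + \<alpha> j\<close> if \<open>n \<ge> j\<close> and by \<open>\<beta> n + \<alpha> n\<close> if \<open>n \<le> j\<close> only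
  decreases \<open>E n j\<close>, so \<open>c E n j\<close> dominates \<open>B n / B j\<close> below the diagonal and \<open>g j / g n\<close> above it. A
  bound along columns controls the tails of \<open>B\<close> and the initial segments of \<open>g\<close>; a bound along rows
  controls the tails of \<open>g\<close> and the initial segments of \<open>B\<close>.\<close>

lemma decay_of_cauchy_matrix:
  fixes \<alpha> \<beta> \<delta> B :: "nat \<Rightarrow> real"
  assumes \<alpha>: "\<And>n. 0 < \<alpha> n" "decseq \<alpha>" and \<beta>: "\<And>n. 0 < \<beta> n" "decseq \<beta>"
    and \<delta>: "\<And>n. 0 < \<delta> n" and B: "\<And>n. 0 < B n" and "c > 0" "p > 0"
    and diag: "\<And>n. \<alpha> n + \<beta> n \<le> c * (\<delta> n * B n)"
    and sums: "(\<forall>j F. finite F \<longrightarrow> (\<Sum>n\<in>F. (\<delta> j * B n / (\<beta> j + \<alpha> n)) powr p) \<le> D) \<or>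
      (\<forall>n F. finite F \<longrightarrow> (\<Sum>j\<in>F. (\<delta> j * B n / (\<beta> j + \<alpha> n)) powr p) \<le> D)"
  shows "unif_exp_decay B \<and> unif_exp_decay (\<lambda>n. (\<alpha> n + \<beta> n) / B n)"
proof -
  define E where "E n j = \<delta> j * B n / (\<beta> j + \<alpha> n)" for n j
  define g where "g n = (\<alpha> n + \<beta> n) / B n" for n
  have pos: "0 < \<alpha> n + \<beta> m" for n m
    using \<alpha>(1)[of n] \<beta>(1)[of m] by simp
  have g: "0 < g n" for n
    using pos B by (simp add: g_def)
  have E: "0 < E n j" for n j
    using \<delta> B pos by (simp add: E_def add.commute)
  have B_le: "B n \<le> c * E n j * B j" if "j \<le> n" for n j
  proof -
    have "\<alpha> n + \<beta> j \<le> \<alpha> j + \<beta> j"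
      using decseqD[OF \<alpha>(2) that] by simp
    also have "\<dots> \<le> c * (\<delta> j * B j)"
      by (rule diag)
    finally have "B n * (\<alpha> n + \<beta> j) \<le> B n * (c * (\<delta> j * B j))"
      using B[of n] by (intro mult_left_mono) auto
    then show ?thesis
      using pos[of n j] by (simp add: E_def field_simps)
  qed
  have g_le: "g j \<le> c * E n j * g n" if "n \<le> j" for n j
  proof -
    have "g j \<le> c * \<delta> j"
      using diag[of j] B[of j] by (simp add: g_def divide_le_eq mult.assoc)
    also have "\<dots> \<le> c * \<delta> j * ((\<alpha> n + \<beta> n) / (\<beta> j + \<alpha> n))"
    proof -
      have "1 \<le> (\<alpha> n + \<beta> n) / (\<beta> j + \<alpha> n)"
        using decseqD[OF \<beta>(2) that] pos[of n j] by (simp add: le_divide_eq)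
      then show ?thesis
        using mult_left_mono[of 1 "(\<alpha> n + \<beta> n) / (\<beta> j + \<alpha> n)" "c * \<delta> j"] \<open>c > 0\<close> \<delta>[of j] by simp
    qed
    also have "\<dots> = c * E n j * g n"
      using B[of n] by (simp add: E_def g_def)
    finally show ?thesis .
  qed
  from sums have "unif_exp_decay B \<and> unif_exp_decay g"
  proof
    assume columns: "\<forall>j F. finite F \<longrightarrow> (\<Sum>n\<in>F. (\<delta> j * B n / (\<beta> j + \<alpha> n)) powr p) \<le> D"
    have "unif_exp_decay B"
      by (rule decay_of_tail_entries[OF B \<open>p > 0\<close> \<open>c > 0\<close>, where e = "\<lambda>n m. E m n" and D = D])
        (use B_le columns E in \<open>auto simp: E_def less_imp_le\<close>)
    moreover have "unif_exp_decay g"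
      by (rule decay_of_initial_entries[OF g \<open>p > 0\<close> \<open>c > 0\<close>, where e = "\<lambda>m n. E n m" and D = D])
        (use g_le columns E in \<open>auto simp: E_def less_imp_le\<close>)
    ultimately show ?thesis ..
  next
    assume rows: "\<forall>n F. finite F \<longrightarrow> (\<Sum>j\<in>F. (\<delta> j * B n / (\<beta> j + \<alpha> n)) powr p) \<le> D"
    have "unif_exp_decay B"
      by (rule decay_of_initial_entries[OF B \<open>p > 0\<close> \<open>c > 0\<close>, where e = E and D = D])
        (use B_le rows E in \<open>auto simp: E_def less_imp_le\<close>)
    moreover have "unif_exp_decay g"
      by (rule decay_of_tail_entries[OF g \<open>p > 0\<close> \<open>c > 0\<close>, where e = E and D = D])
        (use g_le rows E in \<open>auto simp: E_def less_imp_le\<close>)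
    ultimately show ?thesis ..
  qed
  then show ?thesis
    by (simp add: g_def[abs_def])
qed

text \<open>The left-hand side of the last hypothesis is at least \<open>x y\<close> and at least \<open>y' y\<close>, while its
  right-hand side is at most \<open>K (x - x') y\<close> and at most \<open>K x y\<close>.\<close>

lemma cross_ratio_bound:
  fixes x x' y y' K :: real
  assumes pos: "0 < x'" "0 < y'" and less: "x' < x" "y' < y" and "1 < K"
    and cross: "(x + y') * (y + x') \<le> K * ((x - x') * (y - y'))"
  shows "x' \<le> (1 - 1 / K) * x" and "y' \<le> K * x"
proof -
  have "x * y \<le> (x + y') * (y + x')"
    using pos less by (intro mult_mono) auto
  also note cross
  also have "K * ((x - x') * (y - y')) \<le> K * (x - x') * y"
    using \<open>1 < K\<close> pos less unfolding mult.assoc by (intro mult_left_mono) auto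
  finally have "x \<le> K * (x - x')"
    using pos less by simp
  then show "x' \<le> (1 - 1 / K) * x"
    using \<open>1 < K\<close> by (simp add: field_simps)
  have "y' * y \<le> (x + y') * (y + x')"
    using pos less by (intro mult_mono) auto
  also note cross
  also have "K * ((x - x') * (y - y')) \<le> K * (x * y)"
    using \<open>1 < K\<close> pos less by (intro mult_left_mono mult_mono) auto
  finally have "y' * y \<le> K * x * y"
    by (simp add: mult.assoc)
  then show "y' \<le> K * x"
    using pos less by simp
qed

text \<open>One step of interlacing costs the factor \<open>K\<close>, and the shift of the index is undone by \<open>r'\<close>.\<close>

lemma comparable_if_interlacing:
  fixes \<alpha> \<beta> :: "nat \<Rightarrow> real"
  assumes \<alpha>: "\<And>n. 0 < \<alpha> n" and "0 < K"
    and \<alpha>_Suc: "\<And>n. \<alpha> (Suc n) \<le> K * \<beta> n" and \<beta>_Suc: "\<And>n. \<beta> (Suc n) \<le> K * \<alpha> n"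
    and r': "0 < r'" "\<And>n. r' \<le> \<alpha> (Suc n) / \<alpha> n"
  shows "\<exists>c1 c2. 0 < c1 \<and> 0 < c2 \<and> (\<forall>n. c1 \<le> \<beta> n / \<alpha> n \<and> \<beta> n / \<alpha> n \<le> c2)"
proof -
  have r'_le: "r' * \<alpha> n \<le> \<alpha> (Suc n)" for n
    using r'(2)[of n] \<alpha>[of n] by (simp add: le_divide_eq)
  have lower: "r' / K \<le> \<beta> n / \<alpha> n" for n
    using order_trans[OF r'_le \<alpha>_Suc, of n] \<open>0 < K\<close> \<alpha>[of n] by (simp add: field_simps)
  have upper: "\<beta> n / \<alpha> n \<le> max (\<beta> 0 / \<alpha> 0) (K / r')" for n
  proof (cases n)
    case (Suc m)
    have "r' * \<beta> n \<le> r' * (K * \<alpha> m)"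
      using \<beta>_Suc[of m] r'(1) by (simp add: Suc)
    also have "\<dots> \<le> K * \<alpha> n"
      using mult_left_mono[OF r'_le[of m], of K] \<open>0 < K\<close> by (simp add: Suc mult_ac)
    finally have "\<beta> n / \<alpha> n \<le> K / r'"
      using r'(1) \<alpha>[of n] by (simp add: field_simps)
    then show ?thesis
      by simp
  qed simp
  have "0 < r' / K" "0 < max (\<beta> 0 / \<alpha> 0) (K / r')"
    using r'(1) \<open>0 < K\<close> by (auto simp: less_max_iff_disj)
  then show ?thesis
    using lower upper by blast
qed

section \<open>The decay theorem\<close>

theorem theorem1p4:
  fixes X :: seq_space
    and a l :: "nat \<Rightarrow> real"
    and b :: "nat \<Rightarrow> complex"
  assumes "banach_seq_space X"
    and "Bseq a"
    and "\<And>n. a n > 0"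
    and "X = Conv \<Longrightarrow> convergent a"
    and "b \<in> seqs X"
    and "\<And>n. l n < 0"
    and "gain_defined (\<lambda>n. complex_of_real (a n)) b (\<lambda>n. complex_of_real (l n))"
    and "in_dual X (gain (\<lambda>n. complex_of_real (a n)) b (\<lambda>n. complex_of_real (l n)))"
    and "diagonalizable X
           (perturbed_op (\<lambda>n. complex_of_real (a n)) b
              (gain (\<lambda>n. complex_of_real (a n)) b (\<lambda>n. complex_of_real (l n))))"
  shows "(\<exists>\<sigma>. decreasing_listing \<sigma> a) \<and> (\<exists>\<tau>. decreasing_listing \<tau> (\<lambda>n. \<bar>l n\<bar>)) \<and>
    (\<forall>\<sigma> \<tau>. decreasing_listing \<sigma> a \<longrightarrow> decreasing_listing \<tau> (\<lambda>n. \<bar>l n\<bar>) \<longrightarrow>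
       (unif_exp_decay_one (\<lambda>n. a (\<sigma> n)) \<and> unif_exp_decay_one (\<lambda>n. \<bar>l (\<tau> n)\<bar>)) \<and>
       unif_exp_decay (\<lambda>n. cmod (b (\<sigma> n))) \<and>
       unif_exp_decay (\<lambda>n. (a (\<sigma> n) - l (\<tau> n)) / cmod (b (\<sigma> n))) \<and>
       ((\<exists>r'. 0 < r' \<and> r' < 1 \<and> (\<forall>n. r' \<le> a (\<sigma> (Suc n)) / a (\<sigma> n))) \<longrightarrow>
          unif_exp_decay (\<lambda>n. a (\<sigma> n) / cmod (b (\<sigma> n))) \<and>
          (\<exists>c1 c2. 0 < c1 \<and> 0 < c2 \<and>
             (\<forall>n. c1 \<le> \<bar>l (\<tau> n)\<bar> / a (\<sigma> n) \<and> \<bar>l (\<tau> n)\<bar> / a (\<sigma> n) \<le> c2))))"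
proof -
  note X = assms(1) and a = assms(3) and l = assms(6)
  have inj_a: "inj a" and b: "\<And>n. b n \<noteq> 0"
    using assms(7) by (auto simp: gain_defined_def inj_def)
  note summable = gain_defined_summable[OF a assms(2) l assms(7)]
  have abs_l: "\<bar>l n\<bar> = - l n" for n
    using l[of n] by simp
  have main: "(unif_exp_decay_one (\<lambda>n. a (\<sigma> n)) \<and> unif_exp_decay_one (\<lambda>n. \<bar>l (\<tau> n)\<bar>)) \<and>
       unif_exp_decay (\<lambda>n. cmod (b (\<sigma> n))) \<and>
       unif_exp_decay (\<lambda>n. (a (\<sigma> n) - l (\<tau> n)) / cmod (b (\<sigma> n))) \<and>
       ((\<exists>r'. 0 < r' \<and> r' < 1 \<and> (\<forall>n. r' \<le> a (\<sigma> (Suc n)) / a (\<sigma> n))) \<longrightarrow>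
          unif_exp_decay (\<lambda>n. a (\<sigma> n) / cmod (b (\<sigma> n))) \<and>
          (\<exists>c1 c2. 0 < c1 \<and> 0 < c2 \<and>
             (\<forall>n. c1 \<le> \<bar>l (\<tau> n)\<bar> / a (\<sigma> n) \<and> \<bar>l (\<tau> n)\<bar> / a (\<sigma> n) \<le> c2)))"
    if \<sigma>: "decreasing_listing \<sigma> a" and \<tau>: "decreasing_listing \<tau> (\<lambda>n. \<bar>l n\<bar>)" for \<sigma> \<tau>
  proof -
    define \<alpha> \<beta> B where "\<alpha> n = a (\<sigma> n)" and "\<beta> n = - l (\<tau> n)" and "B n = cmod (b (\<sigma> n))" for n
    have bij: "bij \<sigma>" "bij \<tau>" and dec: "decseq \<alpha>" "decseq \<beta>"
      using \<sigma> \<tau> by (auto simp: decreasing_listing_def \<alpha>_def[abs_def] \<beta>_def[abs_def] abs_l)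
    have \<alpha>: "0 < \<alpha> n" and \<beta>: "0 < \<beta> n" and B: "0 < B n" for n
      using a l b by (auto simp: \<alpha>_def \<beta>_def B_def)
    obtain \<delta> C K p D where C: "0 < C" and K: "1 < K" and p: "0 < p" and \<delta>: "\<forall>n. 0 < \<delta> n"
      and dec\<alpha>: "\<forall>n m. n < m \<longrightarrow> \<alpha> m < \<alpha> n" and dec\<beta>: "\<forall>n m. n < m \<longrightarrow> \<beta> m < \<beta> n"
      and diag: "\<forall>n. \<alpha> n + \<beta> n \<le> C * (\<delta> n * B n)"
      and cross: "\<forall>n m. n < m \<longrightarrow>
        (\<alpha> n + \<beta> m) * (\<beta> n + \<alpha> m) \<le> K * ((\<alpha> n - \<alpha> m) * (\<beta> n - \<beta> m))"
      and sums: "(\<forall>j F. finite F \<longrightarrow> (\<Sum>n\<in>F. (\<delta> j * B n / (\<beta> j + \<alpha> n)) powr p) \<le> D) \<or>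
        (\<forall>n F. finite F \<longrightarrow> (\<Sum>j\<in>F. (\<delta> j * B n / (\<beta> j + \<alpha> n)) powr p) \<le> D)"
      by (rule sorted_eigenvector_bounds[OF X a inj_a summable(1) l summable(2) assms(5) b
            assms(8,9) bij \<alpha>_def \<beta>_def B_def dec]) (rule that)
    have \<alpha>_Suc: "\<alpha> (Suc n) \<le> (1 - 1 / K) * \<alpha> n" "\<beta> (Suc n) \<le> K * \<alpha> n" for n
      by (rule cross_ratio_bound[where y = "\<beta> n" and y' = "\<beta> (Suc n)" and x' = "\<alpha> (Suc n)"];
          use \<alpha> \<beta> dec\<alpha> dec\<beta> cross K in simp)+
    have cross': "(\<beta> n + \<alpha> (Suc n)) * (\<alpha> n + \<beta> (Suc n))
        \<le> K * ((\<beta> n - \<beta> (Suc n)) * (\<alpha> n - \<alpha> (Suc n)))" for n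
      using cross[rule_format, of n "Suc n"]
      by (simp add: mult.commute[of "\<beta> n + \<alpha> (Suc n)"] mult.commute[of "\<beta> n - \<beta> (Suc n)"])
    have \<beta>_Suc: "\<beta> (Suc n) \<le> (1 - 1 / K) * \<beta> n" "\<alpha> (Suc n) \<le> K * \<beta> n" for n
      by (rule cross_ratio_bound[where y = "\<alpha> n" and y' = "\<alpha> (Suc n)" and x' = "\<beta> (Suc n)"];
          use \<alpha> \<beta> dec\<alpha> dec\<beta> cross' K in simp)+
    have decay_one: "unif_exp_decay_one \<alpha>" "unif_exp_decay_one \<beta>"
      using \<alpha>_Suc(1) \<beta>_Suc(1) K
      by (auto intro!: unif_exp_decay_one_of_ratio[of "1 - 1 / K"] \<alpha> \<beta>)
    have decay: "unif_exp_decay B" "unif_exp_decay (\<lambda>n. (\<alpha> n + \<beta> n) / B n)"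
      using decay_of_cauchy_matrix[of \<alpha> \<beta> \<delta> B C p D, OF \<alpha> dec(1) \<beta> dec(2) _ B C p _ sums] \<delta> diag
      by auto
    have comparable: "unif_exp_decay (\<lambda>n. \<alpha> n / B n) \<and>
        (\<exists>c1 c2. 0 < c1 \<and> 0 < c2 \<and> (\<forall>n. c1 \<le> \<beta> n / \<alpha> n \<and> \<beta> n / \<alpha> n \<le> c2))"
      if ratio: "\<exists>r'. 0 < r' \<and> r' < 1 \<and> (\<forall>n. r' \<le> \<alpha> (Suc n) / \<alpha> n)"
    proof -
      from ratio obtain r' where r': "0 < r'" "\<And>n. r' \<le> \<alpha> (Suc n) / \<alpha> n"
        by blast
      have "0 < K"
        using K by simp
      obtain c1 c2 where c: "0 < c1" "0 < c2" "\<forall>n. c1 \<le> \<beta> n / \<alpha> n \<and> \<beta> n / \<alpha> n \<le> c2"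
        using comparable_if_interlacing[of \<alpha> K \<beta> r', OF \<alpha> \<open>0 < K\<close> \<beta>_Suc(2) \<alpha>_Suc(2) r'] by blast
      have "unif_exp_decay (\<lambda>n. \<alpha> n / B n)"
      proof (rule unif_exp_decay_of_comparable[OF decay(2)])
        show "0 < 1 / (1 + c2)"
          using c(2) by simp
        show "\<alpha> n / B n \<le> (\<alpha> n + \<beta> n) / B n" for n
          using \<beta>[of n] B[of n] by (intro divide_right_mono) auto
        show "1 / (1 + c2) * ((\<alpha> n + \<beta> n) / B n) \<le> \<alpha> n / B n" for n
        proof -
          have "\<alpha> n + \<beta> n \<le> (1 + c2) * \<alpha> n"
            using spec[OF c(3), of n] \<alpha>[of n] by (simp add: divide_le_eq algebra_simps)
          then have "(\<alpha> n + \<beta> n) / (1 + c2) \<le> \<alpha> n"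
            using c(2) by (simp add: divide_le_eq mult.commute)
          then have "(\<alpha> n + \<beta> n) / (1 + c2) / B n \<le> \<alpha> n / B n"
            using B[of n] by (intro divide_right_mono) auto
          then show ?thesis
            by (simp add: mult.commute)
        qed
      qed
      then show ?thesis
        using c by blast
    qed
    have eqs: "\<bar>l (\<tau> n)\<bar> = \<beta> n" "a (\<sigma> n) = \<alpha> n" "cmod (b (\<sigma> n)) = B n" "\<alpha> n - l (\<tau> n) = \<alpha> n + \<beta> n" for n
      by (simp_all add: abs_l \<alpha>_def \<beta>_def B_def)
    show ?thesis
      unfolding eqs by (intro conjI impI decay_one decay comparable[THEN conjunct1] comparable[THEN conjunct2])
  qed
  have "\<exists>\<sigma>. decreasing_listing \<sigma> a"
    by (rule decreasing_listing_exists[OF summable_LIMSEQ_zero[OF summable(1)] a])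
  moreover have "\<exists>\<tau>. decreasing_listing \<tau> (\<lambda>n. \<bar>l n\<bar>)"
    using l summable_LIMSEQ_zero[OF summable(2)]
    by (intro decreasing_listing_exists tendsto_rabs_zero) (auto simp: abs_l)
  ultimately show ?thesis
    by (intro conjI allI impI main)
qed

end
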